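(* There is an absolute constant $C>0$ such that the following holds. Let $h\ge 1$, $\Delta>0$, and let $P\in\mathcal C(h)$ be such that every hole $P_i$ satisfies ${\rm diam}_2(P_i)\le \Delta\cdot{\rm diam}_2(P)$. Then \[\varrho(P)\le C\left(1+\min\{h^{3/4}\Delta,\;h^{1/2}\Delta^{1/2}\}\right).\] In particular, if $\Delta\le c\,h^{-1/3}$ for a constant $c>0$, then $\varrho(P)\le C'h^{1/3}$ with $C'$ depending only on $c$.
   Context: For $h\in\mathbb N$, $\mathcal C(h)$ denotes the family of polygonal domains $P=P_0\setminus\bigcup_{i=1}^h \operatorname{int}(P_i)$, where $P_0$ is a convex polygon in the plane and $P_1,\dots,P_h$ (the holes) are pairwise disjoint convex polygons contained in the interior of $P_0$. For $s,t\in P$, $|st|$ is the Euclidean distance and ${\rm geod}(s,t)$ is the infimum of the Euclidean lengths of polygonal paths from $s$ to $t$ contained in $P$. The Euclidean diameter is ${\rm diam}_2(P)=\sup_{s,t\in P}|st|$, the geodesic diameter is ${\rm diam}_g(P)=\sup_{s,t\in P}{\rm geod}(s,t)$, and the distortion is $\varrho(P)={\rm diam}_g(P)/{\rm diam}_2(P)$. For a hole $P_i$, ${\rm diam}_2(P_i)$ is its Euclidean diameter. *)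

theory Defs
  imports "HOL-Analysis.Analysis"
begin

type_synonym pt = "real^2"

definition convex_polygon :: "pt set \<Rightarrow> bool" where
  "convex_polygon Q \<longleftrightarrow> (\<exists>S. finite S \<and> Q = convex hull S \<and> interior Q \<noteq> {})"

definition in_class_C :: "nat \<Rightarrow> pt set \<Rightarrow> (nat \<Rightarrow> pt set) \<Rightarrow> bool" where
  "in_class_C h P0 H \<longleftrightarrow> convex_polygon P0 \<and>
     (\<forall>i\<in>{1..h}. convex_polygon (H i) \<and> H i \<subseteq> interior P0) \<and>
     (\<forall>i\<in>{1..h}. \<forall>j\<in>{1..h}. i \<noteq> j \<longrightarrow> H i \<inter> H j = {})"

definition poly_domain :: "nat \<Rightarrow> pt set \<Rightarrow> (nat \<Rightarrow> pt set) \<Rightarrow> pt set" where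
  "poly_domain h P0 H = P0 - (\<Union>i\<in>{1..h}. interior (H i))"

definition polygonal_path_in :: "pt set \<Rightarrow> pt \<Rightarrow> pt \<Rightarrow> pt list \<Rightarrow> bool" where
  "polygonal_path_in P s t ps \<longleftrightarrow> ps \<noteq> [] \<and> hd ps = s \<and> last ps = t \<and>
     (\<forall>(a,b)\<in>set (zip ps (tl ps)). closed_segment a b \<subseteq> P)"

definition poly_length :: "pt list \<Rightarrow> real" where
  "poly_length ps = sum_list (map (\<lambda>(a,b). dist a b) (zip ps (tl ps)))"

definition geod :: "pt set \<Rightarrow> pt \<Rightarrow> pt \<Rightarrow> real" where
  "geod P s t = Inf {poly_length ps | ps. polygonal_path_in P s t ps}"

definition diam_g :: "pt set \<Rightarrow> real" where
  "diam_g P = (SUP s\<in>P. SUP t\<in>P. geod P s t)"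

definition diam_2 :: "pt set \<Rightarrow> real" where
  "diam_2 P = (SUP s\<in>P. SUP t\<in>P. dist s t)"

definition distortion :: "pt set \<Rightarrow> real" where
  "distortion P = diam_g P / diam_2 P"

end

theory Submission
  imports Defs
begin

text \<open>
  Fix a direction \<open>e\<close> and walk from \<open>s\<close> greedily: move along \<open>e\<close> and, when blocked by a hole, slide along
  one of its edges so that \<open>e \<bullet> x\<close> increases. Call an edge steep if it makes angle less than about \<open>1/k\<close>
  with the normal of \<open>e\<close>. Sliding along the other edges costs at most \<open>k\<close> times the progress in
  \<open>e \<bullet> x\<close>, and every steep edge is used at most once. An edge is steep for an \<open>O(1/k)\<close> fraction of the
  directions, and hole \<open>i\<close> has perimeter \<open>O(diam H\<^sub>i) \<le> O(D)\<close>, where \<open>D = \<Delta> diam P\<close>; so for a suitable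
  \<open>e\<close> progress \<open>\<rho>\<close> costs \<open>O(k \<rho> + h D / k)\<close>. Walking up to the outer boundary with \<open>k = 2 + (h \<Delta>)\<^bsup>1/2\<^esup>\<close>
  gives the bound \<open>(h \<Delta>)\<^bsup>1/2\<^esup>\<close>.

  For the other bound take \<open>\<rho> = h\<^bsup>1/2\<^esup> D\<close> and \<open>k = 2 h\<^bsup>1/4\<^esup>\<close>: every line \<open>e \<bullet> x = y\<close> with \<open>y\<close> within \<open>\<rho>\<close> above
  \<open>e \<bullet> s\<close> is reached at cost \<open>O(h\<^bsup>3/4\<^esup> D)\<close> (or the outer boundary is), and one of these lines meets only
  \<open>O(h D / \<rho>) = O(h\<^bsup>1/2\<^esup>)\<close> holes. Following it to the outer boundary, with a detour around each hole,
  costs \<open>diam P + O(h\<^bsup>1/2\<^esup> D)\<close>. Finally two points of the outer boundary are joined along it.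
\<close>

section \<open>Path lengths and averaging\<close>

text \<open>The last argument bounds the length of a polygonal path from above, so bounds can be
  weakened, and added along concatenations, without carrying vertex lists. As in
  \<open>polygonal_path_in\<close>, the trivial path puts no condition on its single point.\<close>

inductive joined :: "pt set \<Rightarrow> pt \<Rightarrow> pt \<Rightarrow> real \<Rightarrow> bool" for P where
  joined_refl: "0 \<le> L \<Longrightarrow> joined P a a L"
| joined_step: "closed_segment a b \<subseteq> P \<Longrightarrow> joined P b c L \<Longrightarrow> dist a b + L \<le> M \<Longrightarrow> joined P a c M"

lemma joined_mono: "joined P a b L \<Longrightarrow> L \<le> M \<Longrightarrow> joined P a b M"
  by (erule joined.cases) (auto intro: joined_refl joined_step order_trans)

lemma joined_subset: "joined P a b L \<Longrightarrow> P \<subseteq> Q \<Longrightarrow> joined Q a b L"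
  by (induction rule: joined.induct) (auto intro: joined.intros)

lemma joined_segment: "closed_segment a b \<subseteq> P \<Longrightarrow> joined P a b (dist a b)"
  using joined_step[OF _ joined_refl[of 0]] by simp

lemma joined_trans:
  assumes "joined P a b L" "joined P b c M"
  shows "joined P a c (L + M)"
  using assms
proof (induction rule: joined.induct)
  case (joined_refl L a)
  then show ?case using joined_mono[of P a c M "L + M"] by simp
next
  case (joined_step a b d L N)
  then show ?case by (intro joined.joined_step[of a b P c "L + M"]) simp_all
qed

lemma joined_sym: "joined P a b L \<Longrightarrow> joined P b a L"
proof (induction rule: joined.induct)
  case (joined_refl L a)
  then show ?case by (rule joined.joined_refl)
next
  case (joined_step a b c L N)
  have "joined P b a (dist a b)"
    using joined_segment[of b a P] joined_step(1) by (simp add: closed_segment_commute dist_commute)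
  from joined_trans[OF joined_step.IH this] show ?case
    using joined_step(3) by (elim joined_mono) simp
qed

lemma joined_imp_path:
  "joined P a b L \<Longrightarrow> \<exists>ps. polygonal_path_in P a b ps \<and> poly_length ps \<le> L"
proof (induction rule: joined.induct)
  case (joined_refl L a)
  then show ?case
    by (intro exI[of _ "[a]"]) (auto simp: polygonal_path_in_def poly_length_def)
next
  case (joined_step a b c L M)
  then obtain ps where ps: "polygonal_path_in P b c ps" "poly_length ps \<le> L" by auto
  then obtain qs where qs: "ps = b # qs"
    by (cases ps) (auto simp: polygonal_path_in_def)
  show ?case using ps joined_step(1,3) unfolding qs
    by (intro exI[of _ "a # b # qs"]) (auto simp: polygonal_path_in_def poly_length_def)
qed

lemma poly_length_nonneg: "0 \<le> poly_length ps"
  unfolding poly_length_def by (intro sum_list_nonneg) auto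

lemma geod_le_joined: "joined P a b L \<Longrightarrow> geod P a b \<le> L"
proof -
  assume "joined P a b L"
  then obtain ps where ps: "polygonal_path_in P a b ps" "poly_length ps \<le> L"
    using joined_imp_path by blast
  have "geod P a b \<le> poly_length ps"
    unfolding geod_def using ps(1)
    by (intro cInf_lower) (auto intro!: bdd_belowI[of _ 0] simp: poly_length_nonneg)
  with ps(2) show ?thesis by simp
qed

text \<open>Boundedness makes both nested suprema genuine: each of them ranges over a set of reals
  that is bounded above.\<close>

lemma dist_le_diam_2:
  assumes "bounded S" "x \<in> S" "y \<in> S"
  shows "dist x y \<le> diam_2 S"
proof -
  obtain B where B: "\<And>a b. a \<in> S \<Longrightarrow> b \<in> S \<Longrightarrow> dist a b \<le> B"
    using assms(1) unfolding bounded_two_points by blast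
  have inner: "(SUP t\<in>S. dist a t) \<le> B" if "a \<in> S" for a
    using that B assms(2) by (intro cSUP_least) auto
  have "dist x y \<le> (SUP t\<in>S. dist x t)"
    using assms B by (intro cSUP_upper) (auto intro!: bdd_aboveI[of _ B])
  also have "\<dots> \<le> diam_2 S"
    unfolding diam_2_def using assms inner by (intro cSUP_upper) (auto intro!: bdd_aboveI[of _ B])
  finally show ?thesis .
qed

text \<open>The event \<open>A i\<close> is confined to a window of length \<open>\<mu>\<close>, so
  the weight of the events, integrated over the interval, is at most \<open>\<mu> * sum w I\<close>;
  it therefore cannot be at least \<open>c\<close> at every point outside the finite, hence null,
  set \<open>X\<close>. This serves twice: to choose a direction with few steep edges, and a level
  line that meets few holes.\<close>

lemma averaging:
  fixes w :: "'i \<Rightarrow> real" and \<alpha> \<beta> \<mu> c :: real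
  assumes fin: "finite I" "finite X" and w: "\<And>i. i \<in> I \<Longrightarrow> 0 \<le> w i"
    and ab: "\<alpha> < \<beta>" and \<mu>: "0 \<le> \<mu>"
    and A: "\<And>i t. i \<in> I \<Longrightarrow> \<alpha> \<le> t \<Longrightarrow> t \<le> \<beta> \<Longrightarrow> A i t \<Longrightarrow> l i \<le> t \<and> t \<le> l i + \<mu>"
    and c: "\<mu> * sum w I < c * (\<beta> - \<alpha>)"
  shows "\<exists>t. \<alpha> \<le> t \<and> t \<le> \<beta> \<and> t \<notin> X \<and> (\<Sum>i\<in>{i\<in>I. A i t}. w i) < c"
proof (rule ccontr)
  assume "\<not> ?thesis"
  then have big: "c \<le> (\<Sum>i\<in>{i\<in>I. A i t}. w i)" if "\<alpha> \<le> t" "t \<le> \<beta>" "t \<notin> X" for t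
    using that by force
  \<comment> \<open>The windows replace the events, so the integrand is integrable even if the
    events are not measurable.\<close>
  define g where "g t = (\<Sum>i\<in>I. w i * indicator {l i..l i + \<mu>} t)" for t
  have int: "integrable lborel (\<lambda>t. w i * indicator {l i..l i + \<mu>} t :: real)" for i
    by (intro integrable_mult_right integrable_real_indicator) (auto simp: emeasure_lborel_Icc_eq)
  have gint: "integrable lborel g"
    unfolding g_def by (intro Bochner_Integration.integrable_sum int)
  have le: "c * indicator {\<alpha>..\<beta>} t \<le> g t" if "t \<notin> X" for t
  proof (cases "t \<in> {\<alpha>..\<beta>}")
    case True
    have "(\<Sum>i\<in>{i\<in>I. A i t}. w i) = (\<Sum>i\<in>I. if A i t then w i else 0)"
      using fin by (simp add: sum.inter_filter)
    also have "\<dots> \<le> g t" unfolding g_def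
      using True A w by (intro sum_mono) (auto simp: indicator_def)
    finally show ?thesis using True big[of t] that by simp
  next
    case False
    then show ?thesis unfolding g_def using w by (auto intro!: sum_nonneg)
  qed
  have "c * (\<beta> - \<alpha>) = (\<integral>t. c * indicator {\<alpha>..\<beta>} t \<partial>lborel)"
    using ab by simp
  also have "\<dots> \<le> (\<integral>t. g t \<partial>lborel)"
  proof (rule integral_mono_AE)
    show "integrable lborel (\<lambda>t. c * indicator {\<alpha>..\<beta>} t :: real)"
      by (intro integrable_mult_right integrable_real_indicator) (auto simp: emeasure_lborel_Icc_eq)
    have "AE t in lborel. t \<notin> X"
      using fin(2) by (intro AE_not_in finite_imp_null_set_lborel)
    then show "AE t in lborel. c * indicator {\<alpha>..\<beta>} t \<le> g t" by eventually_elim (rule le)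
  qed (rule gint)
  also have "\<dots> = (\<Sum>i\<in>I. w i * \<mu>)"
    unfolding g_def using int \<mu> by (subst Bochner_Integration.integral_sum) auto
  also have "\<dots> = \<mu> * sum w I" by (simp add: sum_distrib_left mult.commute)
  finally show False using c by simp
qed

section \<open>Sides of a convex polygon\<close>

definition perp :: "pt \<Rightarrow> pt" where
  "perp x = vector [- (x $ 2), x $ 1]"

lemma perp_nth [simp]: "perp x $ 1 = - (x $ 2)" "perp x $ 2 = x $ 1"
  by (simp_all add: perp_def vector_2)

lemma inner_pt: "(x::pt) \<bullet> y = x $ 1 * y $ 1 + x $ 2 * y $ 2"
  by (simp add: inner_vec_def sum_2)

lemma pt_eq_iff: "(x::pt) = y \<longleftrightarrow> x $ 1 = y $ 1 \<and> x $ 2 = y $ 2"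
  by (auto simp: vec_eq_iff forall_2)

lemma inner_perp [simp]: "a \<bullet> perp a = 0"
  by (simp add: inner_pt)

lemma perp_eq_0_iff [simp]: "perp a = 0 \<longleftrightarrow> a = 0"
  by (auto simp: pt_eq_iff)

lemma norm_perp [simp]: "norm (perp a) = norm a"
  by (simp add: norm_eq_sqrt_inner inner_pt algebra_simps)

lemma inner_eq_0_imp_perp:
  assumes "a \<noteq> 0" "a \<bullet> x = 0"
  shows "x = ((perp a \<bullet> x) / (a \<bullet> a)) *\<^sub>R perp a"
proof -
  have s: "a \<bullet> a \<noteq> 0" using assms(1) by simp
  \<comment> \<open>This is the orthogonal decomposition of \<open>x\<close> along \<open>a\<close>
    and \<open>perp a\<close>, multiplied by the squared norm of \<open>a\<close>, whose
    \<open>a\<close> component vanishes.\<close>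
  have "(a \<bullet> a) *\<^sub>R x = (perp a \<bullet> x) *\<^sub>R perp a"
    using assms(2) by (simp add: pt_eq_iff inner_pt) algebra
  then have "(1 / (a \<bullet> a)) *\<^sub>R ((a \<bullet> a) *\<^sub>R x) = (1 / (a \<bullet> a)) *\<^sub>R ((perp a \<bullet> x) *\<^sub>R perp a)"
    by simp
  then show ?thesis using s by simp
qed

lemma inner_perp_eqI:
  assumes "f \<noteq> 0" "f \<bullet> x = f \<bullet> y" "perp f \<bullet> x = perp f \<bullet> y"
  shows "x = y"
proof -
  have "x - y = ((perp f \<bullet> (x - y)) / (f \<bullet> f)) *\<^sub>R perp f"
    using assms by (intro inner_eq_0_imp_perp) (simp_all add: inner_diff_right)
  then show ?thesis using assms(3) by (simp add: inner_diff_right)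
qed

text \<open>Redundant half-planes are allowed. With unit normals and nonempty interior, a constraint
  is determined by any two distinct points where it is tight, so sides can be indexed by
  constraints.\<close>

locale halfplane_polygon =
  fixes N :: "(pt \<times> real) set" and Q :: "pt set"
  assumes finite_N: "finite N"
    and norm_N: "\<And>a b. (a, b) \<in> N \<Longrightarrow> norm a = 1"
    and Q_eq: "Q = {x. \<forall>(a, b)\<in>N. a \<bullet> x \<le> b}"
    and bounded_Q: "bounded Q"
    and interior_Q: "interior Q \<noteq> {}"
begin

lemma Q_le: "x \<in> Q \<Longrightarrow> (a, b) \<in> N \<Longrightarrow> a \<bullet> x \<le> b"
  using Q_eq by auto

lemma Q_Inter: "Q = (\<Inter>n\<in>N. {x. fst n \<bullet> x \<le> snd n})"
  by (simp add: Q_eq case_prod_unfold set_eq_iff)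

lemma closed_Q: "closed Q"
  unfolding Q_Inter by (intro closed_INT ballI closed_halfspace_le)

lemma compact_Q: "compact Q"
  using closed_Q bounded_Q by (simp add: compact_eq_bounded_closed)

lemma convex_Q: "convex Q"
  unfolding Q_Inter by (intro convex_INT convex_halfspace_le)

lemma interior_strict:
  assumes "x \<in> interior Q" "(a, b) \<in> N"
  shows "a \<bullet> x < b"
proof -
  obtain r where r: "r > 0" "cball x r \<subseteq> Q" using assms(1) mem_interior_cball by blast
  have n: "norm a = 1" using norm_N assms(2) by auto
  have "x + r *\<^sub>R a \<in> cball x r" using r n by (simp add: dist_norm)
  then have "a \<bullet> (x + r *\<^sub>R a) \<le> b" using r(2) Q_le assms(2) by blast
  then show ?thesis using r(1) n by (simp add: inner_add_right dot_square_norm)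
qed

lemma frontier_iff: "p \<in> frontier Q \<longleftrightarrow> p \<in> Q \<and> (\<exists>(a, b)\<in>N. a \<bullet> p = b)"
proof -
  have "p \<in> interior Q" if p: "p \<in> Q" and not_tight: "\<forall>(a, b)\<in>N. a \<bullet> p \<noteq> b"
  proof (rule interiorI)
    show "open (\<Inter>n\<in>N. {x. fst n \<bullet> x < snd n})"
      by (intro open_INT finite_N ballI open_halfspace_lt)
    show "p \<in> (\<Inter>n\<in>N. {x. fst n \<bullet> x < snd n})"
      using p not_tight Q_le by (fastforce simp: order_less_le)
    show "(\<Inter>n\<in>N. {x. fst n \<bullet> x < snd n}) \<subseteq> Q"
      unfolding Q_Inter by (intro subsetI INT_I) (fastforce intro: less_imp_le)
  qed
  then show ?thesis
    using interior_strict closed_Q by (fastforce simp: frontier_def)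
qed

text \<open>The slack at an interior point of a segment is a combination, with positive weights, of
  the nonnegative slacks at the ends; if it is zero, both of these are.\<close>

lemma tight_segment:
  assumes "(a, b) \<in> N" "u \<in> Q" "v \<in> Q" "z \<in> open_segment u v" "a \<bullet> z = b"
  shows "a \<bullet> u = b \<and> a \<bullet> v = b"
proof -
  obtain t where t: "0 < t" "t < 1" "z = (1 - t) *\<^sub>R u + t *\<^sub>R v"
    using assms(4) by (auto simp: in_segment)
  have le: "a \<bullet> u \<le> b" "a \<bullet> v \<le> b" using assms Q_le by auto
  have "(1 - t) * (b - a \<bullet> u) + t * (b - a \<bullet> v) = 0"
    using assms(5) t(3) by (simp add: inner_add_right algebra_simps)
  moreover have "(1 - t) * (b - a \<bullet> u) \<ge> 0" "t * (b - a \<bullet> v) \<ge> 0" using t le by auto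
  ultimately have "(1 - t) * (b - a \<bullet> u) = 0 \<and> t * (b - a \<bullet> v) = 0" by linarith
  then show ?thesis using t by auto
qed

text \<open>Both normals are unit vectors orthogonal to \<open>x - y\<close>, so they agree up to
  sign; opposite signs would squeeze the polygon into a line and leave no interior point.\<close>

lemma tight_unique:
  assumes "(a, b) \<in> N" "(a', b') \<in> N" "x \<noteq> y"
    and "a \<bullet> x = b" "a \<bullet> y = b" "a' \<bullet> x = b'" "a' \<bullet> y = b'"
  shows "(a, b) = (a', b')"
proof -
  have n: "norm a = 1" "norm a' = 1" using assms norm_N by auto
  define w where "w = perp (x - y)"
  have w0: "x - y \<noteq> 0" using assms by simp
  obtain c where c: "a = c *\<^sub>R w"
    using inner_eq_0_imp_perp[OF w0, of a] assms(4-7) unfolding w_def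
    by (metis inner_commute inner_diff_right right_minus_eq)
  obtain c' where c': "a' = c' *\<^sub>R w"
    using inner_eq_0_imp_perp[OF w0, of a'] assms(4-7) unfolding w_def
    by (metis inner_commute inner_diff_right right_minus_eq)
  have w1: "norm w > 0" using w0 by (simp add: w_def)
  have "\<bar>c\<bar> * norm w = \<bar>c'\<bar> * norm w" using n unfolding c c' by simp
  then have "\<bar>c\<bar> = \<bar>c'\<bar>" using w1 by simp
  then consider "c' = c" | "c' = - c" by linarith
  then show ?thesis
  proof cases
    case 1
    then show ?thesis using assms c c' by simp
  next
    case 2
    then have a': "a' = - a" using c c' by simp
    obtain z0 where z0: "z0 \<in> interior Q" using interior_Q by auto
    have "a \<bullet> z0 < b" "a' \<bullet> z0 < b'" using interior_strict z0 assms by auto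
    then show ?thesis using assms a' by simp
  qed
qed

definition side :: "pt \<times> real \<Rightarrow> pt set" where
  "side n = Q \<inter> {x. fst n \<bullet> x = snd n}"

text \<open>A constraint may be redundant, or tight at a single vertex only. Those tight at two
  points carry the sides in the usual sense.\<close>

definition proper :: "(pt \<times> real) set" where
  "proper = {n \<in> N. \<exists>x\<in>side n. \<exists>y\<in>side n. x \<noteq> y}"

lemma side_segment:
  assumes "n \<in> proper"
  shows "\<exists>e. side n = closed_segment (fst e) (snd e) \<and> fst e \<noteq> snd e"
proof -
  obtain a b where n: "n = (a, b)" by force
  have N: "(a, b) \<in> N" using assms n by (auto simp: proper_def)
  then have a: "a \<noteq> 0" using norm_N by force
  have "compact (side n)"
    unfolding side_def by (intro compact_Int_closed compact_Q closed_hyperplane)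
  moreover have "convex (side n)"
    unfolding side_def by (intro convex_Int convex_Q convex_hyperplane)
  moreover have "collinear (side n)"
    unfolding collinear_def
  proof (intro exI[of _ "perp a"] ballI)
    fix x y assume "x \<in> side n" "y \<in> side n"
    then have "a \<bullet> (x - y) = 0" by (simp add: side_def n inner_diff_right)
    then show "\<exists>c. x - y = c *\<^sub>R perp a" using inner_eq_0_imp_perp[OF a] by blast
  qed
  moreover have "side n \<noteq> {}" using assms by (auto simp: proper_def)
  ultimately obtain u v where "side n = closed_segment u v"
    using compact_convex_collinear_segment by blast
  moreover have "u \<noteq> v" using assms calculation by (auto simp: proper_def)
  ultimately show ?thesis by (intro exI[of _ "(u, v)"]) simp
qed

text \<open>The order of the two endpoints is arbitrary, so heights of a side are always taken
  through \<open>min\<close> and \<open>max\<close>.\<close>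

definition ends :: "pt \<times> real \<Rightarrow> pt \<times> pt" where
  "ends n = (SOME e. side n = closed_segment (fst e) (snd e) \<and> fst e \<noteq> snd e)"

lemma ends:
  assumes "n \<in> proper"
  shows "side n = closed_segment (fst (ends n)) (snd (ends n))" "fst (ends n) \<noteq> snd (ends n)"
  using someI_ex[OF side_segment[OF assms]] unfolding ends_def by auto

lemma ends_in_side:
  assumes "n \<in> proper"
  shows "fst (ends n) \<in> side n" "snd (ends n) \<in> side n"
  using ends(1)[OF assms] by auto

lemma side_subset_frontier: "n \<in> proper \<Longrightarrow> side n \<subseteq> frontier Q"
  by (auto simp: frontier_iff side_def proper_def) force

text \<open>Some constraint is tight at the midpoint of the segment, hence at both ends by
  \<open>tight_segment\<close>.\<close>

lemma segment_in_side:
  assumes "x \<noteq> y" "closed_segment x y \<subseteq> frontier Q"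
  shows "\<exists>n\<in>proper. x \<in> side n \<and> y \<in> side n"
proof -
  have xy: "x \<in> Q" "y \<in> Q" using assms frontier_iff by auto
  have mid: "midpoint x y \<in> open_segment x y" using assms(1) by simp
  then have "midpoint x y \<in> frontier Q" using assms(2) open_closed_segment by blast
  then obtain a b where ab: "(a, b) \<in> N" "a \<bullet> midpoint x y = b" using frontier_iff by auto
  have "a \<bullet> x = b \<and> a \<bullet> y = b" using tight_segment[OF ab(1) xy mid ab(2)] .
  then show ?thesis
    using ab(1) xy assms(1) by (intro bexI[of _ "(a, b)"]) (auto simp: side_def proper_def)
qed

text \<open>Constraints tight at \<open>p\<close> do not grow along \<open>d\<close>; the finitely
  many slack ones survive a short step by continuity.\<close>

lemma small_step:
  assumes "p \<in> Q" "\<And>a b. (a, b) \<in> N \<Longrightarrow> a \<bullet> p = b \<Longrightarrow> a \<bullet> d \<le> 0"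
  shows "\<exists>\<epsilon>>0. p + \<epsilon> *\<^sub>R d \<in> Q"
proof -
  have "\<forall>\<^sub>F \<epsilon> in at_right 0. fst n \<bullet> (p + \<epsilon> *\<^sub>R d) \<le> snd n" if "n \<in> N" for n
  proof (cases "fst n \<bullet> p = snd n")
    case True
    then have "fst n \<bullet> d \<le> 0" using assms(2) that by (metis prod.collapse)
    with True show ?thesis
      by (auto simp: eventually_at_filter inner_add_right mult_nonneg_nonpos intro!: always_eventually)
  next
    case False
    then have "fst n \<bullet> p < snd n" using Q_le[OF assms(1), of "fst n" "snd n"] that by simp
    moreover have "((\<lambda>\<epsilon>. fst n \<bullet> (p + \<epsilon> *\<^sub>R d)) \<longlongrightarrow> fst n \<bullet> (p + 0 *\<^sub>R d)) (at_right 0)"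
      by (intro tendsto_intros)
    ultimately have "\<forall>\<^sub>F \<epsilon> in at_right 0. fst n \<bullet> (p + \<epsilon> *\<^sub>R d) < snd n"
      by (intro order_tendstoD) auto
    then show ?thesis by eventually_elim simp
  qed
  then have "\<forall>\<^sub>F \<epsilon> in at_right 0. \<forall>n\<in>N. fst n \<bullet> (p + \<epsilon> *\<^sub>R d) \<le> snd n"
    using finite_N by (simp add: eventually_ball_finite)
  moreover have "\<forall>\<^sub>F \<epsilon> in at_right (0::real). \<epsilon> > 0" by (rule eventually_at_right_less)
  ultimately have "\<forall>\<^sub>F \<epsilon> in at_right 0. \<epsilon> > 0 \<and> p + \<epsilon> *\<^sub>R d \<in> Q"
    by eventually_elim (auto simp: Q_Inter)
  then show ?thesis using eventually_happens[of _ "at_right (0::real)"] by auto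
qed

text \<open>A feasible direction along which an active constraint stays tight runs inside a side of
  the polygon, hence on its boundary.\<close>

lemma tight_step:
  assumes "p \<in> Q" "(a, b) \<in> N" "a \<bullet> p = b" "a \<bullet> d = 0" "d \<noteq> 0" "e \<bullet> d \<ge> 0"
    and "\<And>a b. (a, b) \<in> N \<Longrightarrow> a \<bullet> p = b \<Longrightarrow> a \<bullet> d \<le> 0"
  shows "\<exists>x. x \<noteq> p \<and> closed_segment p x \<subseteq> frontier Q \<and> e \<bullet> p \<le> e \<bullet> x"
proof -
  obtain \<epsilon> where \<epsilon>: "\<epsilon> > 0" "p + \<epsilon> *\<^sub>R d \<in> Q" using small_step[of p d] assms(1,7) by blast
  define x where "x = p + \<epsilon> *\<^sub>R d"
  have s: "x \<in> side (a, b)" "p \<in> side (a, b)"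
    using \<epsilon> assms by (auto simp: x_def side_def inner_add_right)
  have xp: "x \<noteq> p" using \<epsilon> assms by (simp add: x_def)
  then have "(a, b) \<in> proper" using s assms(2) by (auto simp: proper_def)
  moreover have "convex (side (a, b))"
    unfolding side_def by (intro convex_Int convex_Q convex_hyperplane)
  ultimately have "closed_segment p x \<subseteq> frontier Q"
    using side_subset_frontier closed_segment_subset[OF s(2,1)] by blast
  moreover have "e \<bullet> p \<le> e \<bullet> x" using \<epsilon> assms by (simp add: x_def inner_add_right)
  ultimately show ?thesis using xp by blast
qed

text \<open>Tilting the direction towards \<open>w\<close> parallel to the level lines of \<open>e\<close> until a constraint
  active at \<open>p\<close> becomes tight yields an edge direction.\<close>

lemma escape:
  assumes p: "p \<in> frontier Q" and w: "w \<in> Q" and ew: "e \<bullet> p < e \<bullet> w"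
  shows "\<exists>x. x \<noteq> p \<and> closed_segment p x \<subseteq> frontier Q \<and> e \<bullet> p \<le> e \<bullet> x"
proof -
  have pQ: "p \<in> Q" using p frontier_iff by auto
  define d where "d = w - p"
  have ed: "e \<bullet> d > 0" using ew by (simp add: d_def inner_diff_right)
  then have e0: "perp e \<noteq> 0" by auto
  have ad: "a \<bullet> d \<le> 0" if "(a, b) \<in> N" "a \<bullet> p = b" for a b
    using Q_le[OF w that(1)] that(2) by (simp add: d_def inner_diff_right)
  define Act where "Act = {n \<in> N. fst n \<bullet> p = snd n}"
  show ?thesis
  proof (cases "\<forall>n\<in>Act. fst n \<bullet> perp e = 0")
    \<comment> \<open>All active normals are parallel to \<open>e\<close>, so motion along the level
      line of \<open>e\<close> keeps every active constraint tight.\<close>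
    case True
    obtain a b where ab: "(a, b) \<in> N" "a \<bullet> p = b" using p frontier_iff by auto
    show ?thesis
      by (rule tight_step[OF pQ ab, where d = "perp e"]) (use True ab e0 in \<open>auto simp: Act_def\<close>)
  next
    case False
    then obtain n0 where n0: "n0 \<in> Act" "fst n0 \<bullet> perp e \<noteq> 0" by auto
    \<comment> \<open>The sign is chosen so that motion along \<open>f\<close> runs against the
      constraint \<open>n0\<close>; since \<open>f\<close> is orthogonal to \<open>e\<close>, adding
      multiples of \<open>f\<close> does not alter the rise.\<close>
    define f where "f = sgn (fst n0 \<bullet> perp e) *\<^sub>R perp e"
    have ef: "e \<bullet> f = 0" by (simp add: f_def)
    define Pos where "Pos = {n \<in> Act. fst n \<bullet> f > 0}"
    have Pos: "finite Pos" "n0 \<in> Pos"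
      using finite_N n0 by (auto simp: Pos_def Act_def f_def sgn_if)
    \<comment> \<open>\<open>r n\<close> is the multiple of \<open>f\<close> at which
      \<open>d + r n *\<^sub>R f\<close> becomes parallel to the line of \<open>n\<close>. The
      smallest one makes its constraint tight before any other active constraint is
      violated.\<close>
    define r where "r n = - (fst n \<bullet> d) / (fst n \<bullet> f)" for n :: "pt \<times> real"
    obtain n where n: "n \<in> Pos" "\<forall>m\<in>Pos. r n \<le> r m"
      using ex_min_if_finite[of "r ` Pos"] Pos by (metis (no_types, lifting) arg_min_if_finite(1,2) emptyE linorder_not_less)
    have r0: "r n \<ge> 0"
      using n(1) ad[of "fst n" "snd n"] by (auto simp: r_def Pos_def Act_def divide_nonpos_pos)
    define d' where "d' = d + r n *\<^sub>R f"
    have ed': "e \<bullet> d' > 0" using ed ef by (simp add: d'_def inner_add_right)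
    show ?thesis
    proof (rule tight_step[OF pQ, where d = d' and a = "fst n" and b = "snd n"])
      show "(fst n, snd n) \<in> N" "fst n \<bullet> p = snd n" using n(1) by (auto simp: Pos_def Act_def)
      show "fst n \<bullet> d' = 0" using n(1) unfolding d'_def inner_add_right inner_scaleR_right
        by (simp add: r_def Pos_def)
      show "d' \<noteq> 0" "e \<bullet> d' \<ge> 0" using ed' by auto
      fix a b assume ab: "(a, b) \<in> N" "a \<bullet> p = b"
      show "a \<bullet> d' \<le> 0"
      proof (cases "a \<bullet> f > 0")
        case True
        then have "(a, b) \<in> Pos" using ab by (simp add: Pos_def Act_def)
        then have "r n \<le> - (a \<bullet> d) / (a \<bullet> f)" using n(2) by (force simp: r_def)
        then show ?thesis using True by (simp add: d'_def inner_add_right field_simps)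
      next
        case False
        then have "r n * (a \<bullet> f) \<le> 0" using r0 by (simp add: mult_nonneg_nonpos)
        then show ?thesis using ad[OF ab] by (simp add: d'_def inner_add_right)
      qed
    qed
  qed
qed

end

section \<open>Perimeter of a convex polygon, by counting crossings with parallel lines\<close>

context halfplane_polygon
begin

lemma crossing_point:
  fixes u v f :: pt
  assumes "min (f \<bullet> u) (f \<bullet> v) < \<tau>" "\<tau> < max (f \<bullet> u) (f \<bullet> v)"
  shows "\<exists>z\<in>open_segment u v. f \<bullet> z = \<tau>"
proof -
  define t where "t = (\<tau> - f \<bullet> u) / (f \<bullet> v - f \<bullet> u)"
  have ne: "f \<bullet> v - f \<bullet> u \<noteq> 0" using assms by linarith
  have t: "0 < t" "t < 1"
    using assms unfolding t_def by (auto simp: field_simps min_def max_def split: if_splits)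
  have "f \<bullet> ((1 - t) *\<^sub>R u + t *\<^sub>R v) = f \<bullet> u + t * (f \<bullet> v - f \<bullet> u)"
    by (simp add: inner_add_right algebra_simps)
  also have "\<dots> = \<tau>" using ne by (simp add: t_def)
  finally show ?thesis using t ne by (intro bexI[of _ "(1 - t) *\<^sub>R u + t *\<^sub>R v"]) (auto simp: in_segment)
qed

text \<open>Different sides are crossed at different points, since a constraint tight at an inner
  point of another side is tight along all of it. Of three crossing points the middle one lies
  strictly between the others, so its constraint is tight at all three; its side then lies on the
  level line and does not cross it.\<close>

lemma at_most_two_crossings:
  fixes f :: pt and \<tau> :: real
  assumes f: "f \<noteq> 0"
  defines "K \<equiv> {n \<in> proper. min (f \<bullet> fst (ends n)) (f \<bullet> snd (ends n)) < \<tau> \<and>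
    \<tau> < max (f \<bullet> fst (ends n)) (f \<bullet> snd (ends n))}"
  shows "card K \<le> 2"
proof (rule ccontr)
  assume "\<not> card K \<le> 2"
  then have card3: "card K > 2" by simp
  have KN: "n \<in> N" "n \<in> proper" if "n \<in> K" for n using that by (auto simp: K_def proper_def)
  have "\<forall>n\<in>K. \<exists>z\<in>open_segment (fst (ends n)) (snd (ends n)). f \<bullet> z = \<tau>"
    using crossing_point by (auto simp: K_def)
  then obtain z where z: "\<And>n. n \<in> K \<Longrightarrow> z n \<in> open_segment (fst (ends n)) (snd (ends n))"
      "\<And>n. n \<in> K \<Longrightarrow> f \<bullet> z n = \<tau>"
    by metis
  have zside: "z n \<in> side n" if "n \<in> K" for n
    using z(1)[OF that] ends(1)[OF KN(2)[OF that]] open_closed_segment by blast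
  define g where "g n = perp f \<bullet> z n" for n
  have inj: "inj_on g K"
  proof (rule inj_onI)
    fix n m assume nm: "n \<in> K" "m \<in> K" "g n = g m"
    then have eq: "z n = z m" using inner_perp_eqI[OF f] z(2) by (metis g_def)
    have e: "fst (ends m) \<in> side m" "snd (ends m) \<in> side m" using ends_in_side KN nm by auto
    have "fst n \<bullet> fst (ends m) = snd n \<and> fst n \<bullet> snd (ends m) = snd n"
      using tight_segment[of "fst n" "snd n" "fst (ends m)" "snd (ends m)" "z m"]
        KN[OF nm(1)] e z(1)[OF nm(2)] zside[OF nm(1)] eq by (auto simp: side_def)
    then have "(fst n, snd n) = (fst m, snd m)"
      using KN nm e ends(2)[OF KN(2)[OF nm(2)]]
      by (intro tight_unique[of _ _ _ _ "fst (ends m)" "snd (ends m)"]) (auto simp: side_def)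
    then show "n = m" by (simp add: prod_eq_iff)
  qed
  have finK: "finite K" using card3 card.infinite by fastforce
  define G where "G = g ` K"
  have G: "finite G" "card G > 2" using finK card3 inj by (auto simp: G_def card_image)
  then have Gne: "G \<noteq> {}" by auto
  have "card {Min G, Max G} \<le> 2" by (simp add: card_insert_if)
  then have "\<not> G \<subseteq> {Min G, Max G}" using G(2) card_mono[of "{Min G, Max G}" G] by auto
  \<comment> \<open>With more than two positions along the level line, one is neither the least nor
    the greatest.\<close>
  then obtain y where y: "y \<in> G" "y \<noteq> Min G" "y \<noteq> Max G" by auto
  then have lt: "Min G < y" "y < Max G" using G(1) by (simp_all add: order_less_le)
  obtain n n1 n2 where n: "n \<in> K" "g n = y" "n1 \<in> K" "g n1 = Min G" "n2 \<in> K" "g n2 = Max G"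
    using y Min_in[OF G(1) Gne] Max_in[OF G(1) Gne] by (auto simp: G_def)
  have lt': "g n1 < g n" "g n < g n2" using lt n by simp_all
  then obtain c where c: "c \<in> open_segment (z n1) (z n2)" "perp f \<bullet> c = g n"
    using crossing_point[of "perp f" "z n1" "z n2" "g n"] by (auto simp: g_def)
  obtain s where "c = (1 - s) *\<^sub>R z n1 + s *\<^sub>R z n2" using c(1) by (auto simp: in_segment)
  then have "f \<bullet> c = \<tau>" using z(2)[OF n(3)] z(2)[OF n(5)]
    by (simp only: inner_add_right inner_scaleR_right) (simp add: algebra_simps)
  then have "c = z n" using inner_perp_eqI[OF f] c(2) z(2) n by (simp add: g_def)
  then have zn: "z n \<in> open_segment (z n1) (z n2)" using c by simp
  obtain a b where ab: "n = (a, b)" by force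
  have abN: "(a, b) \<in> N" using KN n ab by auto
  then have a0: "a \<noteq> 0" using norm_N by force
  have "a \<bullet> z n1 = b \<and> a \<bullet> z n2 = b"
    using tight_segment[OF abN _ _ zn] zside n ab by (auto simp: side_def)
  then have "a \<bullet> (z n1 - z n2) = 0" by (simp add: inner_diff_right)
  then obtain s1 where s1: "z n1 - z n2 = s1 *\<^sub>R perp a" using inner_eq_0_imp_perp[OF a0] by blast
  have "z n1 \<noteq> z n2" using lt' by (auto simp: g_def)
  then have "s1 \<noteq> 0" using s1 by auto
  moreover have "s1 * (f \<bullet> perp a) = 0"
    using arg_cong[OF s1, of "\<lambda>x. f \<bullet> x"] z(2) n by (simp add: inner_diff_right)
  ultimately have fa: "f \<bullet> perp a = 0" by simp
  have "a \<bullet> (fst (ends n) - snd (ends n)) = 0"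
    using ends_in_side[OF KN(2)[OF n(1)]] ab by (simp add: side_def inner_diff_right)
  then obtain s2 where "fst (ends n) - snd (ends n) = s2 *\<^sub>R perp a"
    using inner_eq_0_imp_perp[OF a0] by blast
  then have "f \<bullet> (fst (ends n) - snd (ends n)) = 0" using fa by simp
  then show False using n(1) by (auto simp: K_def inner_diff_right)
qed

lemma finite_proper: "finite proper"
  using finite_N by (simp add: proper_def)

text \<open>The projected lengths add up to the integral, over all levels, of the number of sides
  crossed. That number is at most 2, and it vanishes outside an interval of length
  \<open>2 * diam_2 Q\<close>.\<close>

lemma projected_perimeter:
  assumes f: "norm f = 1"
  shows "(\<Sum>n\<in>proper. \<bar>f \<bullet> (snd (ends n) - fst (ends n))\<bar>) \<le> 4 * diam_2 Q"
proof -
  define l where "l n = min (f \<bullet> fst (ends n)) (f \<bullet> snd (ends n))" for n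
  define r where "r n = max (f \<bullet> fst (ends n)) (f \<bullet> snd (ends n))" for n
  have lr: "l n \<le> r n" for n by (simp add: l_def r_def)
  obtain z0 where z0: "z0 \<in> Q" using interior_Q interior_subset by blast
  define D where "D = diam_2 Q"
  have D: "\<bar>f \<bullet> x - f \<bullet> z0\<bar> \<le> D" if "x \<in> Q" for x
  proof -
    have "\<bar>f \<bullet> (x - z0)\<bar> \<le> norm f * norm (x - z0)" by (rule Cauchy_Schwarz_ineq2)
    also have "\<dots> \<le> D" using dist_le_diam_2[OF bounded_Q that z0] f by (simp add: D_def dist_norm)
    finally show ?thesis by (simp add: inner_diff_right)
  qed
  have D0: "D \<ge> 0" using D[OF z0] by simp
  have int: "integrable lborel (\<lambda>t. indicator {l n<..<r n} t :: real)" for n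
    using lr[of n] by (intro integrable_real_indicator) auto
  have le: "(\<Sum>n\<in>proper. indicator {l n<..<r n} t) \<le> (2 * indicator {f \<bullet> z0 - D..f \<bullet> z0 + D} t :: real)" for t :: real
  proof -
    have eq: "(\<Sum>n\<in>proper. indicator {l n<..<r n} t) = real (card {n\<in>proper. l n < t \<and> t < r n})"
      using finite_proper by (simp add: indicator_def sum.If_cases Int_def)
    show ?thesis
    proof (cases "{n\<in>proper. l n < t \<and> t < r n} = {}")
      case True
      then show ?thesis unfolding eq True by simp
    next
      case False
      then obtain n where n: "n \<in> proper" "l n < t" "t < r n" by auto
      have "fst (ends n) \<in> Q" "snd (ends n) \<in> Q" using ends_in_side[OF n(1)] by (auto simp: side_def)
      then have "t \<in> {f \<bullet> z0 - D..f \<bullet> z0 + D}"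
        using n D[of "fst (ends n)"] D[of "snd (ends n)"] by (auto simp: l_def r_def)
      moreover have "card {n\<in>proper. l n < t \<and> t < r n} \<le> 2"
        using at_most_two_crossings[of f t] f unfolding l_def r_def by force
      ultimately show ?thesis using eq by simp
    qed
  qed
  have "(\<Sum>n\<in>proper. \<bar>f \<bullet> (snd (ends n) - fst (ends n))\<bar>) = (\<Sum>n\<in>proper. r n - l n)"
    by (intro sum.cong) (auto simp: l_def r_def inner_diff_right)
  also have "\<dots> = (\<integral>t. (\<Sum>n\<in>proper. indicator {l n<..<r n} t) \<partial>lborel)"
    using int lr by (subst Bochner_Integration.integral_sum) auto
  also have "\<dots> \<le> (\<integral>t. 2 * indicator {f \<bullet> z0 - D..f \<bullet> z0 + D} t \<partial>lborel)"
  proof (intro integral_mono le)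
    show "integrable lborel (\<lambda>t. \<Sum>n\<in>proper. indicator {l n<..<r n} t :: real)"
      by (intro Bochner_Integration.integrable_sum int)
    show "integrable lborel (\<lambda>t. 2 * indicator {f \<bullet> z0 - D..f \<bullet> z0 + D} t :: real)"
      by (intro integrable_mult_right integrable_real_indicator) (auto simp: emeasure_lborel_Icc_eq)
  qed
  also have "\<dots> = 4 * D" using D0 by simp
  finally show ?thesis by (simp add: D_def)
qed

text \<open>The length of a side is at most the sum of its projections to the two axes, each of
  which contributes \<open>4 * diam_2 Q\<close> in total.\<close>

lemma perimeter: "(\<Sum>n\<in>proper. dist (fst (ends n)) (snd (ends n))) \<le> 8 * diam_2 Q"
proof -
  have "dist (fst (ends n)) (snd (ends n)) \<le> \<bar>axis 1 1 \<bullet> (snd (ends n) - fst (ends n))\<bar>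
      + \<bar>axis 2 1 \<bullet> (snd (ends n) - fst (ends n))\<bar>" for n
    using norm_le_l1_cart[of "snd (ends n) - fst (ends n)"]
    by (simp add: dist_norm norm_minus_commute sum_2 inner_axis' UNIV_2)
  then have "(\<Sum>n\<in>proper. dist (fst (ends n)) (snd (ends n))) \<le>
      (\<Sum>n\<in>proper. \<bar>axis 1 1 \<bullet> (snd (ends n) - fst (ends n))\<bar>) +
      (\<Sum>n\<in>proper. \<bar>axis 2 1 \<bullet> (snd (ends n) - fst (ends n))\<bar>)"
    by (subst sum.distrib[symmetric]) (rule sum_mono)
  then show ?thesis
    using projected_perimeter[of "axis 1 1"] projected_perimeter[of "axis 2 1"] by (simp add: norm_axis_1)
qed

end

text \<open>An interface that hides the half-planes: the walks below use only these properties of a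
  polygon. An edge is stored with an arbitrary orientation.\<close>

locale polygon_edges =
  fixes Q :: "pt set" and E :: "(pt \<times> pt) set"
  assumes finite_E: "finite E"
    and edge_frontier: "\<And>u v. (u, v) \<in> E \<Longrightarrow> closed_segment u v \<subseteq> frontier Q"
    and edge_ne: "\<And>u v. (u, v) \<in> E \<Longrightarrow> u \<noteq> v"
    and segment_in_edge: "\<And>x y. x \<noteq> y \<Longrightarrow> closed_segment x y \<subseteq> frontier Q \<Longrightarrow>
      \<exists>(u, v)\<in>E. x \<in> closed_segment u v \<and> y \<in> closed_segment u v"
    and escape: "\<And>p w e. p \<in> frontier Q \<Longrightarrow> w \<in> Q \<Longrightarrow> e \<bullet> p < e \<bullet> w \<Longrightarrow>
      \<exists>x. x \<noteq> p \<and> closed_segment p x \<subseteq> frontier Q \<and> e \<bullet> p \<le> e \<bullet> x"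
    and perimeter_le: "(\<Sum>(u, v)\<in>E. dist u v) \<le> 8 * diam_2 Q"
    and compact_Q: "compact Q"
    and convex_Q: "convex Q"

lemma (in halfplane_polygon) polygon_edges: "polygon_edges Q (ends ` proper)"
proof
  show "finite (ends ` proper)" using finite_proper by simp
  show "closed_segment u v \<subseteq> frontier Q" if "(u, v) \<in> ends ` proper" for u v
    using that ends(1) side_subset_frontier by (metis fst_conv imageE snd_conv)
  show "u \<noteq> v" if "(u, v) \<in> ends ` proper" for u v
    using that ends(2) by (metis fst_conv imageE snd_conv)
  show "\<exists>(u, v)\<in>ends ` proper. x \<in> closed_segment u v \<and> y \<in> closed_segment u v"
    if "x \<noteq> y" "closed_segment x y \<subseteq> frontier Q" for x y
    using segment_in_side[OF that] ends(1) by (auto simp: case_prod_unfold)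
  show "\<exists>x. x \<noteq> p \<and> closed_segment p x \<subseteq> frontier Q \<and> e \<bullet> p \<le> e \<bullet> x"
    if "p \<in> frontier Q" "w \<in> Q" "e \<bullet> p < e \<bullet> w" for p w e
    using escape that by blast
  have "(\<Sum>(u, v)\<in>ends ` proper. dist u v) \<le> (\<Sum>n\<in>proper. dist (fst (ends n)) (snd (ends n)))"
    using sum_image_le[OF finite_proper, of "\<lambda>(u, v). dist u v" ends] by (auto simp: case_prod_unfold)
  then show "(\<Sum>(u, v)\<in>ends ` proper. dist u v) \<le> 8 * diam_2 Q" using perimeter by linarith
qed (rule compact_Q convex_Q)+

text \<open>A polytope is a finite intersection of half-spaces; dividing each inequality by the norm
  of its normal gives the required representation.\<close>

lemma convex_polygon_edges:
  assumes "convex_polygon Q"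
  shows "\<exists>E. polygon_edges Q E"
proof -
  obtain S where S: "finite S" "Q = convex hull S" "interior Q \<noteq> {}"
    using assms by (auto simp: convex_polygon_def)
  have poly: "polytope Q" using S by (auto simp: polytope_def)
  obtain F where F: "finite F" "Q = \<Inter>F" "\<forall>h\<in>F. \<exists>a b. a \<noteq> 0 \<and> h = {x. a \<bullet> x \<le> b}"
    using polytope_imp_polyhedron[OF poly] unfolding polyhedron_def by metis
  then obtain a b where ab: "\<And>h. h \<in> F \<Longrightarrow> a h \<noteq> 0 \<and> h = {x. a h \<bullet> x \<le> b h}" by metis
  define N where "N = (\<lambda>h. (a h /\<^sub>R norm (a h), b h / norm (a h))) ` F"
  have "halfplane_polygon N Q"
  proof
    show "finite N" using F by (simp add: N_def)
    show "norm c = 1" if "(c, d) \<in> N" for c d using that ab by (auto simp: N_def)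
    have "x \<in> h \<longleftrightarrow> (a h /\<^sub>R norm (a h)) \<bullet> x \<le> b h / norm (a h)" if "h \<in> F" for x h
    proof -
      have "x \<in> h \<longleftrightarrow> a h \<bullet> x \<le> b h" using ab[OF that] by blast
      then show ?thesis using ab[OF that] by (simp add: field_simps)
    qed
    then show "Q = {x. \<forall>(a, b)\<in>N. a \<bullet> x \<le> b}" unfolding N_def F(2) by auto
    show "bounded Q" using poly polytope_imp_bounded by blast
    show "interior Q \<noteq> {}" by (rule S(3))
  qed
  then show ?thesis using halfplane_polygon.polygon_edges by blast
qed

section \<open>Climbing the boundary of a polygon\<close>

text \<open>Directions are parametrized linearly rather than by angle:
  \<open>tilt t \<bullet> w\<close> is affine in \<open>t\<close>, so being nearly orthogonal to a
  given edge confines \<open>t\<close> to an interval of explicit length.\<close>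

definition tilt :: "real \<Rightarrow> pt" where
  "tilt t = vector [1, t]"

lemma tilt_inner: "tilt t \<bullet> x = x $ 1 + t * x $ 2"
  by (simp add: inner_pt tilt_def vector_2)

lemma norm_tilt:
  assumes "0 \<le> t" "t \<le> 1"
  shows "1 \<le> norm (tilt t)" "norm (tilt t) \<le> 2"
proof -
  have "norm (tilt t) = sqrt (1 + t\<^sup>2)"
    by (simp add: norm_eq_sqrt_inner inner_pt tilt_def vector_2 power2_eq_square)
  moreover have "t\<^sup>2 \<le> 1" using assms by (simp add: power_le_one)
  ultimately show "1 \<le> norm (tilt t)" "norm (tilt t) \<le> 2"
    by (auto intro!: real_le_lsqrt)
qed

definition generic :: "pt \<Rightarrow> (pt \<times> pt) set \<Rightarrow> bool" where
  "generic e E \<longleftrightarrow> (\<forall>(u, v)\<in>E. e \<bullet> u \<noteq> e \<bullet> v)"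

text \<open>For distinct \<open>u\<close> and \<open>v\<close> the equation of their heights is a
  nontrivial affine equation in \<open>t\<close>, so each edge rules out at most one
  \<open>t\<close>.\<close>

lemma finite_not_generic:
  assumes "finite E" "\<And>u v. (u, v) \<in> E \<Longrightarrow> u \<noteq> v"
  shows "finite {t. \<not> generic (tilt t) E}"
proof -
  have "{t. \<not> generic (tilt t) E} = (\<Union>(u, v)\<in>E. {t. tilt t \<bullet> u = tilt t \<bullet> v})"
    by (auto simp: generic_def)
  moreover have "finite {t. tilt t \<bullet> u = tilt t \<bullet> v}" if "(u, v) \<in> E" for u v
  proof (rule finite_subset)
    have uv: "u $ 1 \<noteq> v $ 1 \<or> u $ 2 \<noteq> v $ 2" using assms(2)[OF that] by (auto simp: pt_eq_iff)
    show "{t. tilt t \<bullet> u = tilt t \<bullet> v} \<subseteq> {(v $ 1 - u $ 1) / (u $ 2 - v $ 2)}"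
    proof (intro subsetI CollectI singletonI, elim CollectE)
      fix t assume "tilt t \<bullet> u = tilt t \<bullet> v"
      then have eq: "t * (u $ 2 - v $ 2) = v $ 1 - u $ 1" by (simp add: tilt_inner algebra_simps)
      then have "u $ 2 - v $ 2 \<noteq> 0" using uv by auto
      then show "t \<in> {(v $ 1 - u $ 1) / (u $ 2 - v $ 2)}" using eq by (simp add: field_simps)
    qed
  qed simp
  ultimately show ?thesis using assms(1) by auto
qed

lemma inner_segment_bounds:
  fixes u v p e :: pt
  assumes "p \<in> closed_segment u v"
  shows "e \<bullet> p \<le> max (e \<bullet> u) (e \<bullet> v)"
proof -
  obtain t where t: "0 \<le> t" "t \<le> 1" "p = (1 - t) *\<^sub>R u + t *\<^sub>R v" using assms by (auto simp: in_segment)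
  have "e \<bullet> p = (1 - t) * (e \<bullet> u) + t * (e \<bullet> v)" by (simp add: t(3) inner_add_right)
  also have "\<dots> \<le> (1 - t) * max (e \<bullet> u) (e \<bullet> v) + t * max (e \<bullet> u) (e \<bullet> v)"
    using t by (intro add_mono mult_left_mono) auto
  finally show ?thesis by (simp add: algebra_simps)
qed

text \<open>A climbing path pays for an edge when it moves to the upper end, and there the edge is no
  longer above the current level; this bounds the total cost and makes the walk terminate.\<close>

definition above :: "pt \<Rightarrow> (pt \<times> pt) set \<Rightarrow> real \<Rightarrow> (pt \<times> pt) set" where
  "above e E \<tau> = {(u, v)\<in>E. \<tau> < max (e \<bullet> u) (e \<bullet> v)}"

lemma finite_above: "finite E \<Longrightarrow> finite (above e E \<tau>)"
  by (auto simp: above_def intro: finite_subset[of _ E])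

lemma above_antimono: "\<tau> \<le> \<tau>' \<Longrightarrow> above e E \<tau>' \<subseteq> above e E \<tau>"
  by (auto simp: above_def)

lemma above_less:
  assumes "(u, v) \<in> E" "\<tau> < max (e \<bullet> u) (e \<bullet> v)" "max (e \<bullet> u) (e \<bullet> v) \<le> \<tau>'"
  shows "(u, v) \<in> above e E \<tau>" "above e E \<tau>' \<subseteq> above e E \<tau> - {(u, v)}"
  using assms by (auto simp: above_def)

lemma sum_above_step:
  fixes g :: "pt \<times> pt \<Rightarrow> real"
  assumes "finite E" "\<And>x. 0 \<le> g x" "(u, v) \<in> E"
    and "\<tau> < max (e \<bullet> u) (e \<bullet> v)" "max (e \<bullet> u) (e \<bullet> v) \<le> \<tau>'"
  shows "g (u, v) + sum g (above e E \<tau>') \<le> sum g (above e E \<tau>)"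
    and "card (above e E \<tau>') < card (above e E \<tau>)"
proof -
  note less = above_less[OF assms(3-5)]
  have "sum g (above e E \<tau>') \<le> sum g (above e E \<tau> - {(u, v)})"
    using less(2) assms(1,2) finite_above by (intro sum_mono2) auto
  then show "g (u, v) + sum g (above e E \<tau>') \<le> sum g (above e E \<tau>)"
    using sum.remove[OF finite_above[OF assms(1)] less(1), of g] by simp
  show "card (above e E \<tau>') < card (above e E \<tau>)"
    using less finite_above[OF assms(1)] by (intro psubset_card_mono) auto
qed

section \<open>Walks on the boundary of a single polygon\<close>

context polygon_edges
begin

lemma frontier_subset: "frontier Q \<subseteq> Q"
  using compact_Q compact_imp_closed frontier_subset_closed by blast

text \<open>The boundary segment given by \<open>escape\<close> lies in an edge. A generic edge is
  not level, so weak ascent along it is strict; the edge is oriented with \<open>v\<close> as its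
  upper end.\<close>

lemma escape_edge:
  assumes "generic e E" "p \<in> frontier Q" "w \<in> Q" "e \<bullet> p < e \<bullet> w"
  shows "\<exists>u v. ((u, v) \<in> E \<or> (v, u) \<in> E) \<and> p \<in> closed_segment u v \<and> e \<bullet> p < e \<bullet> v \<and> e \<bullet> u < e \<bullet> v"
proof -
  obtain x where x: "x \<noteq> p" "closed_segment p x \<subseteq> frontier Q" "e \<bullet> p \<le> e \<bullet> x"
    using escape assms by blast
  obtain u v where uv: "(u, v) \<in> E" "p \<in> closed_segment u v" "x \<in> closed_segment u v"
    using segment_in_edge[of p x] x by auto
  have ne: "e \<bullet> u \<noteq> e \<bullet> v" using assms(1) uv(1) by (auto simp: generic_def)
  obtain t where t: "p = u + t *\<^sub>R (v - u)" "0 \<le> t" "t \<le> 1"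
    using uv(2) by (auto simp: in_segment algebra_simps)
  obtain s where s: "x = u + s *\<^sub>R (v - u)" "0 \<le> s" "s \<le> 1"
    using uv(3) by (auto simp: in_segment algebra_simps)
  have st: "s \<noteq> t" using x(1) s(1) t(1) by auto
  have ep: "e \<bullet> p = e \<bullet> u + t * (e \<bullet> v - e \<bullet> u)"
    by (simp add: t(1) inner_add_right inner_diff_right)
  have ex: "e \<bullet> x = e \<bullet> u + s * (e \<bullet> v - e \<bullet> u)"
    by (simp add: s(1) inner_add_right inner_diff_right)
  have "e \<bullet> p \<noteq> e \<bullet> x" using ep ex st ne by auto
  then have lt: "e \<bullet> p < e \<bullet> x" using x(3) by simp
  then have lt': "e \<bullet> p < max (e \<bullet> u) (e \<bullet> v)"
    using inner_segment_bounds[OF uv(3), of e] by simp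
  show ?thesis
  proof (cases "e \<bullet> u < e \<bullet> v")
    case True
    then show ?thesis using uv lt' by (intro exI[of _ u] exI[of _ v]) auto
  next
    case False
    then show ?thesis using uv lt' ne
      by (intro exI[of _ v] exI[of _ u]) (auto simp: closed_segment_commute)
  qed
qed

text \<open>From a point that is not highest, \<open>escape_edge\<close> supplies an edge to follow
  to its upper end. Induction on the number of edges that still reach above the current
  level.\<close>

lemma climb:
  assumes g: "generic e E" and p: "p \<in> frontier Q"
  shows "\<exists>m\<in>frontier Q. (\<forall>w\<in>Q. e \<bullet> w \<le> e \<bullet> m) \<and>
    joined (frontier Q) p m (\<Sum>(u, v)\<in>above e E (e \<bullet> p). dist u v)"
  using p
proof (induction "card (above e E (e \<bullet> p))" arbitrary: p rule: less_induct)
  case less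
  have sum0: "0 \<le> (\<Sum>(u, v)\<in>above e E \<tau>. dist u v)" for \<tau> by (intro sum_nonneg) auto
  show ?case
  proof (cases "\<forall>w\<in>Q. e \<bullet> w \<le> e \<bullet> p")
    case True
    then show ?thesis using less.prems sum0 by (intro bexI[of _ p]) (auto intro: joined_refl)
  next
    case False
    then obtain u v where uv: "(u, v) \<in> E \<or> (v, u) \<in> E" "p \<in> closed_segment u v" "e \<bullet> p < e \<bullet> v" "e \<bullet> u < e \<bullet> v"
      using escape_edge[OF g less.prems] by (meson not_le)
    \<comment> \<open>Back to the stored orientation; \<open>max\<close>, length and segment do not
      depend on it.\<close>
    obtain u' v' where uv': "(u', v') \<in> E" "max (e \<bullet> u') (e \<bullet> v') = e \<bullet> v" "dist u' v' = dist u v"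
        "closed_segment u v = closed_segment u' v'"
      using uv(1,4) by (metis closed_segment_commute dist_commute less_imp_le max.absorb1 max.absorb2)
    have seg: "closed_segment p v \<subseteq> closed_segment u v"
      using uv(2) by (simp add: subset_closed_segment)
    have front: "closed_segment u v \<subseteq> frontier Q" using edge_frontier[OF uv'(1)] uv'(4) by (simp only:)
    have step: "dist u' v' + (\<Sum>(u, v)\<in>above e E (e \<bullet> v). dist u v) \<le> (\<Sum>(u, v)\<in>above e E (e \<bullet> p). dist u v)"
      "card (above e E (e \<bullet> v)) < card (above e E (e \<bullet> p))"
      using sum_above_step[OF finite_E _ uv'(1), of "\<lambda>(u, v). dist u v" "e \<bullet> p" e "e \<bullet> v"] uv'(2) uv(3)
      by auto
    obtain m where m: "m \<in> frontier Q" "\<forall>w\<in>Q. e \<bullet> w \<le> e \<bullet> m"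
        "joined (frontier Q) v m (\<Sum>(u, v)\<in>above e E (e \<bullet> v). dist u v)"
      using less.hyps[OF step(2)] front by auto
    have "dist p v \<le> dist u v" using uv(2) by (simp add: dist_in_closed_segment)
    then have "joined (frontier Q) p m (\<Sum>(u, v)\<in>above e E (e \<bullet> p). dist u v)"
      using joined_step[OF _ m(3)] seg front step(1) uv'(3) by auto
    then show ?thesis using m by auto
  qed
qed

text \<open>A maximizer cannot be interior, and the segment between two maximizers consists of
  maximizers. It would lie on the boundary, hence in an edge, which would then be level, against
  genericity.\<close>

lemma max_unique:
  assumes g: "generic e E" and e: "e \<noteq> 0"
    and m: "m \<in> Q" "\<And>w. w \<in> Q \<Longrightarrow> e \<bullet> w \<le> e \<bullet> m"
    and m': "m' \<in> Q" "e \<bullet> m' = e \<bullet> m"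
  shows "m' = m"
proof (rule ccontr)
  assume ne: "m' \<noteq> m"
  have "closed_segment m' m \<subseteq> frontier Q"
  proof
    fix z assume z: "z \<in> closed_segment m' m"
    then have zQ: "z \<in> Q" using closed_segment_subset[OF m'(1) m(1) convex_Q] by auto
    have ez: "e \<bullet> z = e \<bullet> m"
      using z m'(2) by (auto simp: in_segment inner_add_right left_diff_distrib)
    have "z \<notin> interior Q"
    proof
      assume "z \<in> interior Q"
      then obtain r where r: "r > 0" "cball z r \<subseteq> Q" using mem_interior_cball by blast
      have "z + (r / norm e) *\<^sub>R e \<in> cball z r" using r e by (simp add: dist_norm)
      then have "e \<bullet> (z + (r / norm e) *\<^sub>R e) \<le> e \<bullet> m" using r(2) m(2) by blast
      moreover have "(r / norm e) * (e \<bullet> e) > 0" using r e by simp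
      ultimately show False using ez by (simp add: inner_add_right)
    qed
    then show "z \<in> frontier Q" using zQ closure_subset by (auto simp: frontier_def)
  qed
  then obtain u v where uv: "(u, v) \<in> E" "m' \<in> closed_segment u v" "m \<in> closed_segment u v"
    using segment_in_edge[OF ne] by auto
  obtain t where t: "m = u + t *\<^sub>R (v - u)"
    using uv(3) by (auto simp: in_segment algebra_simps)
  obtain s where s: "m' = u + s *\<^sub>R (v - u)"
    using uv(2) by (auto simp: in_segment algebra_simps)
  have "s \<noteq> t" using ne s t by auto
  moreover have "(s - t) * (e \<bullet> v - e \<bullet> u) = 0"
    using m'(2) unfolding s t inner_add_right inner_scaleR_right inner_diff_right by (simp add: algebra_simps)
  ultimately have "e \<bullet> u = e \<bullet> v" by simp
  then show False using g uv(1) by (auto simp: generic_def)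
qed

text \<open>In a generic direction both points climb to the same highest point, each at a cost of at
  most the perimeter bound \<open>8 * diam_2 Q\<close>.\<close>

lemma frontier_joined:
  assumes "p \<in> frontier Q" "q \<in> frontier Q"
  shows "joined (frontier Q) p q (16 * diam_2 Q)"
proof -
  have "finite {t. \<not> generic (tilt t) E}" using finite_not_generic[OF finite_E edge_ne] .
  then obtain t where "t \<in> UNIV - {t. \<not> generic (tilt t) E}"
    by (metis Diff_infinite_finite ex_in_conv finite.emptyI infinite_UNIV_char_0)
  then have g: "generic (tilt t) E" by simp
  have e0: "tilt t \<noteq> 0" by (auto simp: pt_eq_iff tilt_def vector_2)
  have le: "(\<Sum>(u, v)\<in>above e E \<tau>. dist u v) \<le> 8 * diam_2 Q" for e \<tau>
  proof -
    have "(\<Sum>(u, v)\<in>above e E \<tau>. dist u v) \<le> (\<Sum>(u, v)\<in>E. dist u v)"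
      by (intro sum_mono2 finite_E) (auto simp: above_def)
    then show ?thesis using perimeter_le by linarith
  qed
  obtain m where m: "m \<in> frontier Q" "\<forall>w\<in>Q. tilt t \<bullet> w \<le> tilt t \<bullet> m"
      "joined (frontier Q) p m (8 * diam_2 Q)"
    using climb[OF g assms(1)] joined_mono[OF _ le] by blast
  obtain m' where m': "m' \<in> frontier Q" "\<forall>w\<in>Q. tilt t \<bullet> w \<le> tilt t \<bullet> m'"
      "joined (frontier Q) q m' (8 * diam_2 Q)"
    using climb[OF g assms(2)] joined_mono[OF _ le] by blast
  have "m' = m"
    using m m' frontier_subset by (intro max_unique[OF g e0]) (auto intro: order_antisym)
  then show ?thesis
    using joined_trans[OF m(3) joined_sym[OF m'(3)[unfolded \<open>m' = m\<close>]]] by (simp add: mult.commute)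
qed

end

section \<open>Greedy paths in a domain with holes\<close>

text \<open>An edge is steep if its rise along \<open>e\<close> is less than the fraction
  \<open>1/k\<close> of its length. The other edges count zero because \<open>k\<close> times the
  rise already pays for sliding along them.\<close>

definition steep_length :: "real \<Rightarrow> pt \<Rightarrow> pt \<times> pt \<Rightarrow> real" where
  "steep_length k e d = (if k * \<bar>e \<bullet> (snd d - fst d)\<bar> < dist (fst d) (snd d)
     then dist (fst d) (snd d) else 0)"

lemma steep_length_nonneg: "0 \<le> steep_length k e d"
  by (simp add: steep_length_def)

lemma steep_length_swap: "steep_length k e (u, v) = steep_length k e (v, u)"
  by (simp add: steep_length_def dist_commute inner_diff_right abs_minus_commute)

text \<open>If the edge is steep, its whole length is available as payment. Otherwise length and
  rise of the piece from \<open>q\<close> to \<open>x\<close> are the same fraction of those of the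
  edge, so the factor \<open>k\<close> carries over.\<close>

lemma slide_cost:
  assumes q: "q \<in> closed_segment u v" and x: "x \<in> closed_segment q v" and uv: "e \<bullet> u < e \<bullet> v" and k: "0 \<le> k"
  shows "dist q x \<le> k * (e \<bullet> x - e \<bullet> q) + steep_length k e (u, v)"
proof -
  obtain t where t: "q = u + t *\<^sub>R (v - u)" "0 \<le> t" "t \<le> 1"
    using q by (auto simp: in_segment algebra_simps)
  obtain s where s: "x = q + s *\<^sub>R (v - q)" "0 \<le> s" "s \<le> 1"
    using x by (auto simp: in_segment algebra_simps)
  define c where "c = s * (1 - t)"
  have "v - q = (1 - t) *\<^sub>R (v - u)" by (simp add: t(1) algebra_simps)
  then have xq: "x = q + c *\<^sub>R (v - u)" using s(1) by (simp add: c_def)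
  have c: "0 \<le> c" "c \<le> 1" using s t by (auto simp: c_def mult_le_one)
  have d: "dist q x = c * dist u v" using c by (simp add: xq dist_norm norm_minus_commute)
  have ex: "e \<bullet> x - e \<bullet> q = c * (e \<bullet> v - e \<bullet> u)" by (simp add: xq inner_add_right inner_diff_right)
  show ?thesis
  proof (cases "k * \<bar>e \<bullet> (v - u)\<bar> < dist u v")
    case True
    have "dist q x \<le> dist u v" using d c by (simp add: mult_left_le_one_le)
    moreover have "0 \<le> k * (e \<bullet> x - e \<bullet> q)" using ex c uv k by simp
    ultimately show ?thesis using True by (simp add: steep_length_def)
  next
    case False
    then have "dist u v \<le> k * (e \<bullet> v - e \<bullet> u)" using uv by (simp add: inner_diff_right)
    then have "c * dist u v \<le> c * (k * (e \<bullet> v - e \<bullet> u))" using c by (simp add: mult_left_mono)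
    then show ?thesis using d ex steep_length_nonneg[of k e "(u, v)"] by (simp add: mult.left_commute)
  qed
qed

locale holed_domain =
  fixes h :: nat and P0 :: "pt set" and H :: "nat \<Rightarrow> pt set" and E0 EE and P :: "pt set"
  assumes P_def: "P = poly_domain h P0 H"
    and outer: "polygon_edges P0 E0"
    and hole: "\<And>i. i \<in> {1..h} \<Longrightarrow> polygon_edges (H i) (EE i)"
    and hole_interior: "\<And>i. i \<in> {1..h} \<Longrightarrow> H i \<subseteq> interior P0"
    and hole_disjoint: "\<And>i j. i \<in> {1..h} \<Longrightarrow> j \<in> {1..h} \<Longrightarrow> i \<noteq> j \<Longrightarrow> H i \<inter> H j = {}"
begin

lemma P_iff: "x \<in> P \<longleftrightarrow> x \<in> P0 \<and> (\<forall>i\<in>{1..h}. x \<notin> interior (H i))"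
  by (auto simp: P_def poly_domain_def)

lemma compact_P0: "compact P0" and convex_P0: "convex P0"
  using outer polygon_edges.compact_Q polygon_edges.convex_Q by auto

lemma closed_P: "closed P"
  unfolding P_def poly_domain_def using compact_P0 compact_imp_closed by (intro closed_Diff open_UN) auto

lemma compact_hole: "i \<in> {1..h} \<Longrightarrow> compact (H i)"
  using hole polygon_edges.compact_Q by blast

lemma convex_hole: "i \<in> {1..h} \<Longrightarrow> convex (H i)"
  using hole polygon_edges.convex_Q by blast

lemma hole_frontier_subset: "i \<in> {1..h} \<Longrightarrow> frontier (H i) \<subseteq> P"
proof
  fix x assume i: "i \<in> {1..h}" and x: "x \<in> frontier (H i)"
  have xH: "x \<in> H i" using polygon_edges.frontier_subset[OF hole[OF i]] x by auto
  have "x \<notin> interior (H j)" if "j \<in> {1..h}" for j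
    using hole_disjoint[OF i that] xH x interior_subset[of "H j"] by (cases "i = j") (auto simp: frontier_def)
  then show "x \<in> P" using P_iff xH hole_interior[OF i] interior_subset by blast
qed

lemma mem_hole_frontier: "i \<in> {1..h} \<Longrightarrow> x \<in> P \<Longrightarrow> x \<in> H i \<Longrightarrow> x \<in> frontier (H i)"
  using P_iff closure_subset by (auto simp: frontier_def)

lemma outer_frontier_subset: "frontier P0 \<subseteq> P"
proof
  fix x assume x: "x \<in> frontier P0"
  then have "x \<in> P0" using polygon_edges.frontier_subset[OF outer] by auto
  moreover have "x \<notin> interior (H j)" if "j \<in> {1..h}" for j
    using x hole_interior[OF that] interior_subset[of "H j"] by (auto simp: frontier_def)
  ultimately show "x \<in> P" by (simp add: P_iff)
qed

end

section \<open>Straight moves until a hole or the outer boundary blocks\<close>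

locale small_holes = holed_domain +
  fixes D :: real
  assumes hole_diam: "\<And>i. i \<in> {1..h} \<Longrightarrow> diam_2 (H i) \<le> D"
    and D_pos: "0 < D"
begin

lemma hole_frontier_joined:
  assumes i: "i \<in> {1..h}" and "p \<in> frontier (H i)" "q \<in> frontier (H i)"
  shows "joined P p q (16 * D)"
proof -
  have "joined P p q (16 * diam_2 (H i))"
    using polygon_edges.frontier_joined[OF hole[OF i] assms(2,3)] hole_frontier_subset[OF i]
    by (rule joined_subset)
  then show ?thesis using joined_mono hole_diam[OF i] by simp
qed

text \<open>If \<open>q\<close> is a highest point of every hole containing it, any move along
  \<open>e\<close> leaves those holes at once. The other holes are closed, so a short move avoids
  them too.\<close>

lemma local_free:
  assumes q: "q \<in> P" "q \<in> interior P0"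
    and top: "\<And>i w. i \<in> {1..h} \<Longrightarrow> q \<in> H i \<Longrightarrow> w \<in> H i \<Longrightarrow> e \<bullet> w \<le> e \<bullet> q"
    and e: "e \<noteq> 0"
  shows "\<exists>\<delta>>0. \<forall>\<sigma>. 0 \<le> \<sigma> \<longrightarrow> \<sigma> \<le> \<delta> \<longrightarrow> q + \<sigma> *\<^sub>R e \<in> P"
proof -
  define U where "U = interior P0 - (\<Union>i\<in>{i\<in>{1..h}. q \<notin> H i}. H i)"
  have "open U"
    unfolding U_def using compact_hole compact_imp_closed by (intro open_Diff closed_UN) auto
  moreover have "q \<in> U" using q by (auto simp: U_def)
  ultimately obtain r where r: "r > 0" "cball q r \<subseteq> U" using open_contains_cball by blast
  have "q + \<sigma> *\<^sub>R e \<in> P" if \<sigma>: "0 \<le> \<sigma>" "\<sigma> \<le> r / norm e" for \<sigma>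
  proof (cases "\<sigma> = 0")
    case True
    then show ?thesis using q by simp
  next
    case False
    then have pos: "\<sigma> * (e \<bullet> e) > 0" using \<sigma> e by simp
    have "\<sigma> * norm e \<le> r" using \<sigma> e by (simp add: field_simps)
    then have "q + \<sigma> *\<^sub>R e \<in> cball q r" using \<sigma> by (simp add: dist_norm)
    then have inU: "q + \<sigma> *\<^sub>R e \<in> U" using r by auto
    have "q + \<sigma> *\<^sub>R e \<notin> H i" if i: "i \<in> {1..h}" for i
    proof (cases "q \<in> H i")
      case True
      then show ?thesis using top[OF i True, of "q + \<sigma> *\<^sub>R e"] pos by (auto simp: inner_add_right)
    next
      case False
      then show ?thesis using inU i by (auto simp: U_def)
    qed
    then show ?thesis using inU interior_subset[of P0] interior_subset by (auto simp: P_iff U_def) blast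
  qed
  then show ?thesis using r e by (intro exI[of _ "r / norm e"]) auto
qed

text \<open>Move for the longest possible time, which is finite because \<open>P0\<close> is
  bounded. By \<open>local_free\<close> the move could be prolonged unless it has reached the outer
  boundary or the boundary of a hole with points still higher.\<close>

lemma free_move:
  assumes p: "p \<in> P" and e: "e \<noteq> 0"
  shows "\<exists>\<tau>\<ge>0. (\<forall>\<sigma>. 0 \<le> \<sigma> \<longrightarrow> \<sigma> \<le> \<tau> \<longrightarrow> p + \<sigma> *\<^sub>R e \<in> P) \<and>
    (p + \<tau> *\<^sub>R e \<in> frontier P0 \<or>
     (\<exists>i\<in>{1..h}. p + \<tau> *\<^sub>R e \<in> frontier (H i) \<and> (\<exists>w\<in>H i. e \<bullet> (p + \<tau> *\<^sub>R e) < e \<bullet> w)))"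
proof -
  define S where "S = {\<tau>. 0 \<le> \<tau> \<and> (\<forall>\<sigma>. 0 \<le> \<sigma> \<longrightarrow> \<sigma> \<le> \<tau> \<longrightarrow> p + \<sigma> *\<^sub>R e \<in> P)}"
  have S0: "0 \<in> S" using p by (auto simp: S_def)
  obtain B where B: "\<And>x y. x \<in> P0 \<Longrightarrow> y \<in> P0 \<Longrightarrow> dist x y \<le> B"
    using compact_imp_bounded[OF compact_P0] unfolding bounded_two_points by blast
  have bdd: "bdd_above S"
  proof (rule bdd_aboveI)
    fix \<tau> assume "\<tau> \<in> S"
    then have "0 \<le> \<tau>" "p + \<tau> *\<^sub>R e \<in> P0" by (auto simp: S_def P_iff)
    then have "\<tau> * norm e \<le> B" using B[of p "p + \<tau> *\<^sub>R e"] p by (simp add: dist_norm P_iff)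
    then show "\<tau> \<le> B / norm e" using e by (simp add: field_simps)
  qed
  define T where "T = Sup S"
  have T0: "T \<ge> 0" unfolding T_def using cSup_upper[OF S0 bdd] .
  have below: "p + \<sigma> *\<^sub>R e \<in> P" if "0 \<le> \<sigma>" "\<sigma> < T" for \<sigma>
    using that less_cSup_iff[OF _ bdd, of \<sigma>] S0 unfolding T_def S_def by force
  \<comment> \<open>The supremum itself is admissible because \<open>P\<close> is closed.\<close>
  have upto: "p + \<sigma> *\<^sub>R e \<in> P" if "0 \<le> \<sigma>" "\<sigma> \<le> T" for \<sigma>
  proof (cases "T = 0")
    case True
    then show ?thesis using that p by simp
  next
    case False
    then have cl: "closure {0..<T} = {0..T}" using T0 by simp
    have "(\<lambda>\<sigma>. p + \<sigma> *\<^sub>R e) ` closure {0..<T} \<subseteq> P"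
      by (intro image_closure_subset closed_P continuous_intros) (use below in auto)
    then show ?thesis using that unfolding cl image_subset_iff by simp
  qed
  define q where "q = p + T *\<^sub>R e"
  have qP: "q \<in> P" using upto[of T] T0 by (simp add: q_def)
  have "q \<in> frontier P0 \<or> (\<exists>i\<in>{1..h}. q \<in> frontier (H i) \<and> (\<exists>w\<in>H i. e \<bullet> q < e \<bullet> w))"
  proof (rule ccontr)
    assume neg: "\<not> ?thesis"
    have "q \<in> interior P0" using neg qP closure_subset by (auto simp: frontier_def P_iff)
    moreover have "e \<bullet> w \<le> e \<bullet> q" if "i \<in> {1..h}" "q \<in> H i" "w \<in> H i" for i w
      using neg that mem_hole_frontier[OF that(1) qP that(2)] by force
    ultimately obtain \<delta> where \<delta>: "\<delta> > 0" "\<And>\<sigma>. 0 \<le> \<sigma> \<Longrightarrow> \<sigma> \<le> \<delta> \<Longrightarrow> q + \<sigma> *\<^sub>R e \<in> P"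
      using local_free[OF qP _ _ e] by blast
    have "p + \<sigma> *\<^sub>R e \<in> P" if "0 \<le> \<sigma>" "\<sigma> \<le> T + \<delta>" for \<sigma>
    proof (cases "\<sigma> \<le> T")
      case True
      then show ?thesis using upto that by simp
    next
      case False
      have "p + \<sigma> *\<^sub>R e = q + (\<sigma> - T) *\<^sub>R e" by (simp add: q_def algebra_simps)
      then show ?thesis using \<delta>(2)[of "\<sigma> - T"] False that by simp
    qed
    then have "T + \<delta> \<in> S" using T0 \<delta>(1) by (auto simp: S_def)
    then have "T + \<delta> \<le> T" unfolding T_def by (intro cSup_upper bdd)
    then show False using \<delta>(1) by simp
  qed
  then show ?thesis using T0 upto by (intro exI[of _ T]) (auto simp: q_def)
qed

section \<open>The edges of all holes and the greedy walk\<close>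

definition edges :: "(pt \<times> pt) set" where
  "edges = (\<Union>i\<in>{1..h}. EE i)"

lemma finite_edges: "finite edges"
  unfolding edges_def using hole polygon_edges.finite_E by blast

lemma edges_ne: "(u, v) \<in> edges \<Longrightarrow> u \<noteq> v"
  unfolding edges_def using hole polygon_edges.edge_ne by blast

lemma edges_length: "(\<Sum>(u, v)\<in>edges. dist u v) \<le> 8 * real h * D"
proof -
  have "(\<Sum>(u, v)\<in>(\<Union>i\<in>I. EE i). dist u v) \<le> 8 * real (card I) * D" if "I \<subseteq> {1..h}" for I
    using finite_subset[OF that, simplified] that
  proof (induction I rule: finite_induct)
    case (insert i I)
    have fin: "finite (EE i)" "finite (\<Union>i\<in>I. EE i)"
      using insert hole polygon_edges.finite_E by blast+
    have "(\<Sum>(u, v)\<in>(\<Union>i\<in>insert i I. EE i). dist u v) \<le>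
        (\<Sum>(u, v)\<in>EE i. dist u v) + (\<Sum>(u, v)\<in>(\<Union>i\<in>I. EE i). dist u v)"
      using sum.union_inter[OF fin, of "\<lambda>(u, v). dist u v"]
        sum_nonneg[of "EE i \<inter> (\<Union>i\<in>I. EE i)" "\<lambda>(u, v). dist u v"] by auto
    moreover have "(\<Sum>(u, v)\<in>EE i. dist u v) \<le> 8 * D"
      using polygon_edges.perimeter_le[OF hole, of i] hole_diam[of i] insert by auto
    ultimately show ?case using insert by (simp add: algebra_simps)
  qed simp
  from this[of "{1..h}"] show ?thesis by (simp add: edges_def)
qed

text \<open>Free moves alternate with slides to the upper end of a blocking edge; the walk is cut
  off at level \<open>T\<close>. By \<open>slide_cost\<close>, a slide costs \<open>k\<close> times
  its rise plus the steep length of its edge, and that edge is not above the level reached. So the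
  budget over \<open>above\<close> suffices, and the number of edges above decreases.\<close>

lemma greedy:
  assumes g: "generic e edges" and e: "1 \<le> norm e" and k: "1 \<le> k" and p: "p \<in> P" and T: "e \<bullet> p \<le> T"
  shows "\<exists>q\<in>P. e \<bullet> p \<le> e \<bullet> q \<and> e \<bullet> q \<le> T \<and> (q \<in> frontier P0 \<or> e \<bullet> q = T) \<and>
    joined P p q (k * (e \<bullet> q - e \<bullet> p) + sum (steep_length k e) (above e edges (e \<bullet> p)))"
  using p T
proof (induction "card (above e edges (e \<bullet> p))" arbitrary: p rule: less_induct)
  case less
  let ?B = "\<lambda>\<tau>. sum (steep_length k e) (above e edges \<tau>)"
  have e0: "e \<noteq> 0" using e by auto
  have B_nonneg: "0 \<le> ?B \<tau>" for \<tau> by (intro sum_nonneg steep_length_nonneg)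
  have B_mono: "?B \<tau>' \<le> ?B \<tau>" if "\<tau> \<le> \<tau>'" for \<tau> \<tau>'
    using above_antimono[OF that] by (intro sum_mono2 finite_above finite_edges steep_length_nonneg) auto
  obtain \<tau> where \<tau>: "\<tau> \<ge> 0" and free: "\<And>\<sigma>. 0 \<le> \<sigma> \<Longrightarrow> \<sigma> \<le> \<tau> \<Longrightarrow> p + \<sigma> *\<^sub>R e \<in> P"
    and stop: "p + \<tau> *\<^sub>R e \<in> frontier P0 \<or>
     (\<exists>i\<in>{1..h}. p + \<tau> *\<^sub>R e \<in> frontier (H i) \<and> (\<exists>w\<in>H i. e \<bullet> (p + \<tau> *\<^sub>R e) < e \<bullet> w))"
    using free_move[OF less.prems(1) e0] by blast
  define q where "q = p + \<tau> *\<^sub>R e"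
  \<comment> \<open>A free move of parameter \<open>\<sigma>\<close> has length
    \<open>\<sigma> * norm e\<close> and rise \<open>\<sigma> * (norm e)\<^sup>2\<close>; as
    \<open>norm e\<close> and \<open>k\<close> are at least 1, the length is at most
    \<open>k\<close> times the rise.\<close>
  have move: "closed_segment p (p + \<sigma> *\<^sub>R e) \<subseteq> P \<and> e \<bullet> p \<le> e \<bullet> (p + \<sigma> *\<^sub>R e) \<and>
      dist p (p + \<sigma> *\<^sub>R e) \<le> k * (e \<bullet> (p + \<sigma> *\<^sub>R e) - e \<bullet> p)" if \<sigma>: "0 \<le> \<sigma>" "\<sigma> \<le> \<tau>" for \<sigma>
  proof (intro conjI)
    show "closed_segment p (p + \<sigma> *\<^sub>R e) \<subseteq> P"
    proof
      fix x assume "x \<in> closed_segment p (p + \<sigma> *\<^sub>R e)"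
      then obtain u where u: "0 \<le> u" "u \<le> 1" "x = p + (u * \<sigma>) *\<^sub>R e"
        by (auto simp: in_segment algebra_simps)
      have "u * \<sigma> \<le> \<sigma>" using u \<sigma> by (simp add: mult_left_le_one_le)
      then show "x \<in> P" using u \<sigma> free[of "u * \<sigma>"] by simp
    qed
    have ex: "e \<bullet> (p + \<sigma> *\<^sub>R e) - e \<bullet> p = \<sigma> * (norm e * norm e)"
      by (simp add: inner_add_right dot_square_norm power2_eq_square)
    have "0 \<le> \<sigma> * (norm e * norm e)" using \<sigma> by simp
    then show "e \<bullet> p \<le> e \<bullet> (p + \<sigma> *\<^sub>R e)" using ex by linarith
    have "1 * norm e \<le> norm e * norm e" using e by (intro mult_right_mono) auto
    then have "\<sigma> * norm e \<le> \<sigma> * (norm e * norm e)" using \<sigma> by (simp add: mult_left_mono)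
    also have "\<dots> \<le> k * (\<sigma> * (norm e * norm e))"
      using k \<open>0 \<le> \<sigma> * (norm e * norm e)\<close> mult_right_mono[of 1 k "\<sigma> * (norm e * norm e)"] by simp
    finally show "dist p (p + \<sigma> *\<^sub>R e) \<le> k * (e \<bullet> (p + \<sigma> *\<^sub>R e) - e \<bullet> p)"
      using \<sigma> ex by (simp add: dist_norm)
  qed
  have pq: "closed_segment p q \<subseteq> P" "e \<bullet> p \<le> e \<bullet> q" "dist p q \<le> k * (e \<bullet> q - e \<bullet> p)"
    using move[of \<tau>] \<tau> by (auto simp: q_def)
  show ?case
  proof (cases "T \<le> e \<bullet> q")
    case True
    \<comment> \<open>The parameter at which the free move passes level \<open>T\<close>
      exactly.\<close>
    define \<sigma> where "\<sigma> = (T - e \<bullet> p) / (e \<bullet> e)"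
    have ee: "e \<bullet> e > 0" using e0 by simp
    have eq: "e \<bullet> q = e \<bullet> p + \<tau> * (e \<bullet> e)" by (simp add: q_def inner_add_right)
    have \<sigma>: "0 \<le> \<sigma>" "\<sigma> \<le> \<tau>"
      using less.prems(2) True ee eq by (auto simp: \<sigma>_def field_simps)
    have ex: "e \<bullet> (p + \<sigma> *\<^sub>R e) = T" using ee by (simp add: inner_add_right \<sigma>_def)
    have "joined P p (p + \<sigma> *\<^sub>R e) (k * (e \<bullet> (p + \<sigma> *\<^sub>R e) - e \<bullet> p) + ?B (e \<bullet> p))"
      using move[OF \<sigma>] B_nonneg[of "e \<bullet> p"] by (intro joined_mono[OF joined_segment]) auto
    then show ?thesis using ex less.prems(2) free[OF \<sigma>] by (intro bexI[of _ "p + \<sigma> *\<^sub>R e"]) auto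
  next
    case below: False
    have qP: "q \<in> P" using pq(1) by auto
    show ?thesis
    proof (cases "q \<in> frontier P0")
      case True
      have "joined P p q (k * (e \<bullet> q - e \<bullet> p) + ?B (e \<bullet> p))"
        using pq B_nonneg[of "e \<bullet> p"] by (intro joined_mono[OF joined_segment]) auto
      then show ?thesis using True below pq qP by (intro bexI[of _ q]) auto
    next
      case False
      then obtain i w where i: "i \<in> {1..h}" "q \<in> frontier (H i)" "w \<in> H i" "e \<bullet> q < e \<bullet> w"
        using stop by (auto simp: q_def)
      have EEi: "EE i \<subseteq> edges" using i by (auto simp: edges_def)
      have "generic e (EE i)" using g EEi by (auto simp: generic_def)
      then obtain u v where uv: "(u, v) \<in> EE i \<or> (v, u) \<in> EE i" "q \<in> closed_segment u v"
          "e \<bullet> q < e \<bullet> v" "e \<bullet> u < e \<bullet> v"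
        using polygon_edges.escape_edge[OF hole[OF i(1)] _ i(2-4)] by blast
      obtain u' v' where uv': "(u', v') \<in> edges" "max (e \<bullet> u') (e \<bullet> v') = e \<bullet> v"
          "steep_length k e (u', v') = steep_length k e (u, v)"
      proof (cases "(u, v) \<in> EE i")
        case True
        then show ?thesis using that[of u v] uv(4) EEi by auto
      next
        case False
        then show ?thesis using that[of v u] uv(1,4) EEi steep_length_swap[of k e u v] by auto
      qed
      have uvP: "closed_segment u v \<subseteq> P"
        using uv(1) polygon_edges.edge_frontier[OF hole[OF i(1)], of u v]
          polygon_edges.edge_frontier[OF hole[OF i(1)], of v u] hole_frontier_subset[OF i(1)]
        by (auto simp: closed_segment_commute)
      have qv: "closed_segment q v \<subseteq> closed_segment u v"
        using uv(2) by (simp add: subset_closed_segment)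
      have step: "steep_length k e (u, v) + ?B (e \<bullet> v) \<le> ?B (e \<bullet> q)"
        "card (above e edges (e \<bullet> v)) < card (above e edges (e \<bullet> q))"
        using sum_above_step[OF finite_edges _ uv'(1), of "steep_length k e" "e \<bullet> q" e "e \<bullet> v"]
          steep_length_nonneg uv' uv(3) by auto
      have Bpq: "?B (e \<bullet> q) \<le> ?B (e \<bullet> p)" using B_mono pq(2) by simp
      show ?thesis
      proof (cases "T \<le> e \<bullet> v")
        case True
        \<comment> \<open>Level \<open>T\<close> is passed during the slide, so the slide stops
          there by the intermediate value theorem.\<close>
        then obtain x where x: "x \<in> closed_segment q v" "e \<bullet> x = T"
          using connected_ivt_hyperplane[of "closed_segment q v" q v e T] below by auto
        have qx: "closed_segment q x \<subseteq> closed_segment q v"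
          using x(1) by (simp add: subset_closed_segment)
        have "dist q x \<le> k * (e \<bullet> x - e \<bullet> q) + steep_length k e (u, v)"
          using slide_cost[OF uv(2) x(1) uv(4)] k by simp
        then have "joined P q x (k * (e \<bullet> x - e \<bullet> q) + ?B (e \<bullet> p))"
          using qx qv uvP step(1) Bpq B_nonneg[of "e \<bullet> v"] by (intro joined_mono[OF joined_segment]) auto
        then have "joined P p x (k * (e \<bullet> x - e \<bullet> p) + ?B (e \<bullet> p))"
          using pq by (elim joined_step[OF pq(1)]) (simp add: algebra_simps)
        then show ?thesis using x less.prems(2) qx qv uvP by (intro bexI[of _ x]) auto
      next
        case False
        have "card (above e edges (e \<bullet> q)) \<le> card (above e edges (e \<bullet> p))"
          using above_antimono[OF pq(2)] by (intro card_mono finite_above finite_edges)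
        then obtain r where r: "r \<in> P" "e \<bullet> v \<le> e \<bullet> r" "e \<bullet> r \<le> T" "r \<in> frontier P0 \<or> e \<bullet> r = T"
            "joined P v r (k * (e \<bullet> r - e \<bullet> v) + ?B (e \<bullet> v))"
          using less.hyps[of v] step(2) uvP False by auto
        have "dist q v \<le> k * (e \<bullet> v - e \<bullet> q) + steep_length k e (u, v)"
          using slide_cost[OF uv(2) _ uv(4)] k by simp
        then have "joined P q r (k * (e \<bullet> r - e \<bullet> q) + ?B (e \<bullet> p))"
          using qv uvP step(1) Bpq by (intro joined_step[OF _ r(5)]) (auto simp: algebra_simps)
        then have "joined P p r (k * (e \<bullet> r - e \<bullet> p) + ?B (e \<bullet> p))"
          using pq by (elim joined_step[OF pq(1)]) (simp add: algebra_simps)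
        then show ?thesis using r pq uv(3) by (intro bexI[of _ r]) auto
      qed
    qed
  qed
qed

end

section \<open>Walking along a line\<close>

lemma line_between:
  fixes a d :: pt
  assumes "s \<le> t" "t \<le> s'"
  shows "a + t *\<^sub>R d \<in> closed_segment (a + s *\<^sub>R d) (a + s' *\<^sub>R d)"
proof (cases "s = s'")
  case True
  then show ?thesis using assms by simp
next
  case False
  define u where "u = (t - s) / (s' - s)"
  have "u * (s' - s) = t - s" using False by (simp add: u_def)
  then have t: "t = (1 - u) * s + u * s'" by (simp add: algebra_simps)
  have "0 \<le> u" "u \<le> 1" using False assms by (auto simp: u_def)
  moreover have "a + t *\<^sub>R d = (1 - u) *\<^sub>R (a + s *\<^sub>R d) + u *\<^sub>R (a + s' *\<^sub>R d)"
    unfolding t by (simp add: algebra_simps)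
  ultimately show ?thesis unfolding in_segment by blast
qed

lemma segment_param:
  fixes a d :: pt
  assumes "x \<in> closed_segment (a + s *\<^sub>R d) (a + s' *\<^sub>R d)" "s \<le> s'"
  shows "\<exists>t. s \<le> t \<and> t \<le> s' \<and> x = a + t *\<^sub>R d"
proof -
  obtain u where u: "0 \<le> u" "u \<le> 1" "x = (1 - u) *\<^sub>R (a + s *\<^sub>R d) + u *\<^sub>R (a + s' *\<^sub>R d)"
    using assms(1) by (auto simp: in_segment)
  have "x = a + (s + u * (s' - s)) *\<^sub>R d" unfolding u(3) by (simp add: algebra_simps)
  moreover have "0 \<le> u * (s' - s)" "u * (s' - s) \<le> s' - s"
    using u assms(2) by (auto simp: mult_left_le_one_le)
  ultimately show ?thesis by (intro exI[of _ "s + u * (s' - s)"]) auto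
qed

section \<open>Straight walks with detours around the holes\<close>

context small_holes
begin

text \<open>The parameters that land in the hole form a compact set; take its least element. Were
  the point there interior to the hole, then either an earlier parameter would land in the hole too,
  or \<open>a\<close> itself would lie in its interior.\<close>

lemma first_entry:
  assumes i: "i \<in> {1..h}" and a: "a \<in> P" and hit: "0 \<le> t0" "a + t0 *\<^sub>R d \<in> H i"
  shows "\<exists>t. 0 \<le> t \<and> t \<le> t0 \<and> a + t *\<^sub>R d \<in> frontier (H i) \<and> (\<forall>s. 0 \<le> s \<longrightarrow> s < t \<longrightarrow> a + s *\<^sub>R d \<notin> H i)"
proof -
  define \<phi> where "\<phi> t = a + t *\<^sub>R d" for t
  have cont: "continuous_on UNIV \<phi>" unfolding \<phi>_def by (intro continuous_intros)
  define S where "S = {0..t0} \<inter> \<phi> -` H i"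
  have "closed (\<phi> -` H i)"
    using cont compact_imp_closed[OF compact_hole[OF i]] by (intro closed_vimage) auto
  then have "compact S" unfolding S_def by (intro compact_Int_closed) auto
  moreover have "t0 \<in> S" using hit by (simp add: S_def \<phi>_def)
  ultimately obtain t where t: "t \<in> S" "\<And>s. s \<in> S \<Longrightarrow> t \<le> s"
    using compact_attains_inf[of S] by blast
  have before: "\<phi> s \<notin> H i" if "0 \<le> s" "s < t" for s
    using t(1) t(2)[of s] that by (auto simp: S_def)
  have "\<phi> t \<notin> interior (H i)"
  proof
    assume int: "\<phi> t \<in> interior (H i)"
    have "t \<noteq> 0" using int a i by (auto simp: \<phi>_def P_iff)
    then have t_pos: "t > 0" using t(1) by (simp add: S_def)
    have "open (\<phi> -` interior (H i))" using cont by (intro open_vimage) auto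
    then obtain r where r: "r > 0" "ball t r \<subseteq> \<phi> -` interior (H i)"
      using int open_contains_ball by (metis vimageI)
    define s where "s = max 0 (t - r / 2)"
    have "s \<in> ball t r" using r t_pos by (auto simp: s_def dist_real_def)
    then have "\<phi> s \<in> H i" using r(2) interior_subset by blast
    then show False using before[of s] t_pos r by (auto simp: s_def)
  qed
  then have "\<phi> t \<in> frontier (H i)" using t(1) closure_subset by (auto simp: frontier_def S_def)
  then show ?thesis using t(1) before by (intro exI[of _ t]) (auto simp: S_def \<phi>_def)
qed

text \<open>Only interiors count: a segment that merely touches a hole there stays in the
  domain.\<close>

definition hit :: "pt \<Rightarrow> pt \<Rightarrow> nat set" where
  "hit a b = {i\<in>{1..h}. closed_segment a b \<inter> interior (H i) \<noteq> {}}"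

lemma finite_hit: "finite (hit a b)"
  by (simp add: hit_def)

text \<open>Pick a hole that is hit, let \<open>p\<close> and \<open>q\<close> be its first points
  as seen from \<open>a\<close> and from \<open>b\<close>, and replace the piece between them by a
  path around the hole. The two outer pieces are treated by induction. Their hit sets are disjoint
  and omit the chosen hole, so the counts add up.\<close>

lemma detour:
  assumes "a \<in> P" "b \<in> P"
  shows "joined P a b (dist a b + 16 * D * real (card (hit a b)))"
  using assms
proof (induction "card (hit a b)" arbitrary: a b rule: less_induct)
  case less
  have ab: "closed_segment a b \<subseteq> P0"
    using less.prems convex_P0 by (intro closed_segment_subset) (auto simp: P_iff)
  show ?case
  proof (cases "hit a b = {}")
    case True
    then have "closed_segment a b \<inter> interior (H i) = {}" if "i \<in> {1..h}" for i
      using that unfolding hit_def by blast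
    then have "closed_segment a b \<subseteq> P" using ab P_iff by blast
    then show ?thesis using True joined_segment by simp
  next
    case False
    then obtain i where i: "i \<in> {1..h}" "closed_segment a b \<inter> interior (H i) \<noteq> {}"
      by (auto simp: hit_def)
    define d where "d = b - a"
    have a0: "a + 0 *\<^sub>R d = a" and b1: "a + 1 *\<^sub>R d = b" by (simp_all add: d_def)
    obtain t0 where t0: "0 \<le> t0" "t0 \<le> 1" "a + t0 *\<^sub>R d \<in> H i"
    proof -
      obtain x where x: "x \<in> closed_segment a b" "x \<in> interior (H i)" using i(2) by blast
      obtain t where "0 \<le> t" "t \<le> 1" "x = a + t *\<^sub>R d"
        using segment_param[of x a 0 d 1] x(1) unfolding a0 b1 by auto
      then show ?thesis using that[of t] x(2) interior_subset[of "H i"] by auto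
    qed
    obtain t1 where t1: "0 \<le> t1" "t1 \<le> t0" "a + t1 *\<^sub>R d \<in> frontier (H i)"
        "\<And>s. 0 \<le> s \<Longrightarrow> s < t1 \<Longrightarrow> a + s *\<^sub>R d \<notin> H i"
      using first_entry[OF i(1) less.prems(1) t0(1,3)] by blast
    \<comment> \<open>The last exit from the hole is a first entry for the segment traversed
      backwards.\<close>
    have rev: "b + s *\<^sub>R (- d) = a + (1 - s) *\<^sub>R d" for s by (simp add: d_def algebra_simps)
    obtain s2 where s2: "0 \<le> s2" "s2 \<le> 1 - t0" "b + s2 *\<^sub>R (- d) \<in> frontier (H i)"
        "\<And>s. 0 \<le> s \<Longrightarrow> s < s2 \<Longrightarrow> b + s *\<^sub>R (- d) \<notin> H i"
      using first_entry[OF i(1) less.prems(2), of "1 - t0" "- d"] t0 unfolding rev by auto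
    define t2 where "t2 = 1 - s2"
    have t2: "t0 \<le> t2" "t2 \<le> 1" "a + t2 *\<^sub>R d \<in> frontier (H i)"
      using s2 unfolding rev by (auto simp: t2_def)
    have t2': "a + s *\<^sub>R d \<notin> H i" if "t2 < s" "s \<le> 1" for s
      using s2(4)[of "1 - s"] that unfolding rev by (simp add: t2_def)
    define p where "p = a + t1 *\<^sub>R d"
    define q where "q = a + t2 *\<^sub>R d"
    have pq: "p \<in> frontier (H i)" "q \<in> frontier (H i)" using t1 t2 by (simp_all add: p_def q_def)
    then have pqH: "p \<in> H i" "q \<in> H i" using polygon_edges.frontier_subset[OF hole[OF i(1)]] by auto
    have pqP: "p \<in> P" "q \<in> P" using pq hole_frontier_subset[OF i(1)] by auto
    have ap: "\<exists>s. 0 \<le> s \<and> s \<le> t1 \<and> x = a + s *\<^sub>R d" if "x \<in> closed_segment a p" for x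
      using segment_param[of x a 0 d t1] that t1(1) by (simp add: p_def)
    have qb: "\<exists>s. t2 \<le> s \<and> s \<le> 1 \<and> x = a + s *\<^sub>R d" if "x \<in> closed_segment q b" for x
      using segment_param[of x a t2 d 1] that t2(2) by (simp add: q_def b1[simplified])
    have i1: "i \<notin> hit a p"
    proof
      assume "i \<in> hit a p"
      then obtain x where x: "x \<in> closed_segment a p" "x \<in> interior (H i)" by (auto simp: hit_def)
      then obtain s where s: "0 \<le> s" "s \<le> t1" "x = a + s *\<^sub>R d" using ap by blast
      then have "s = t1" using t1(4)[of s] x(2) interior_subset by force
      then show False using x(2) s(3) pq(1) by (simp add: p_def frontier_def)
    qed
    have i2: "i \<notin> hit q b"
    proof
      assume "i \<in> hit q b"
      then obtain x where x: "x \<in> closed_segment q b" "x \<in> interior (H i)" by (auto simp: hit_def)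
      then obtain s where s: "t2 \<le> s" "s \<le> 1" "x = a + s *\<^sub>R d" using qb by blast
      then have "s = t2" using t2'[of s] x(2) interior_subset by force
      then show False using x(2) s(3) pq(2) by (simp add: q_def frontier_def)
    qed
    \<comment> \<open>By convexity, a hole met by both outer pieces would contain \<open>p\<close>.
      Since holes are disjoint it would be the chosen hole, which neither piece hits.\<close>
    have disj: "hit a p \<inter> hit q b = {}"
    proof (rule ccontr)
      assume "hit a p \<inter> hit q b \<noteq> {}"
      then obtain j where j: "j \<in> hit a p" "j \<in> hit q b" by auto
      then have jh: "j \<in> {1..h}" by (simp add: hit_def)
      obtain x y where x: "x \<in> closed_segment a p" "x \<in> H j" and y: "y \<in> closed_segment q b" "y \<in> H j"
        using j interior_subset[of "H j"] by (auto simp: hit_def)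
      obtain s s' where s: "s \<le> t1" "a + s *\<^sub>R d \<in> H j" "t2 \<le> s'" "a + s' *\<^sub>R d \<in> H j"
        using ap[OF x(1)] qb[OF y(1)] x(2) y(2) by auto
      have "p \<in> closed_segment (a + s *\<^sub>R d) (a + s' *\<^sub>R d)"
        unfolding p_def using s t1 t2 by (intro line_between) auto
      then have "p \<in> H j" using closed_segment_subset[OF s(2,4) convex_hole[OF jh]] by auto
      then have "i = j" using pqH(1) hole_disjoint[OF i(1) jh] by auto
      then show False using i1 j by simp
    qed
    have sub1: "closed_segment a p \<subseteq> closed_segment a b"
      using line_between[of 0 t1 1 a d] t1 t0 unfolding a0 b1 p_def[symmetric]
      by (simp add: subset_closed_segment)
    have sub2: "closed_segment q b \<subseteq> closed_segment a b"
      using line_between[of 0 t2 1 a d] t2 t0 unfolding a0 b1 q_def[symmetric]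
      by (simp add: subset_closed_segment)
    have sub: "hit a p \<union> hit q b \<subseteq> hit a b - {i}"
      using sub1 sub2 i1 i2 by (auto simp: hit_def)
    have iab: "i \<in> hit a b" using i by (simp add: hit_def)
    have "card (hit a p) + card (hit q b) = card (hit a p \<union> hit q b)"
      using disj finite_hit by (simp add: card_Un_disjoint)
    also have "\<dots> \<le> card (hit a b - {i})" using sub finite_hit by (intro card_mono) auto
    also have "\<dots> = card (hit a b) - 1" using iab by simp
    finally have "card (hit a p) + card (hit q b) \<le> card (hit a b) - 1" .
    moreover have "card (hit a b) > 0" using iab finite_hit card_gt_0_iff by blast
    ultimately have card: "card (hit a p) + card (hit q b) + 1 \<le> card (hit a b)" by linarith
    have j1: "joined P a p (dist a p + 16 * D * real (card (hit a p)))"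
      using less.hyps[of a p] card less.prems pqP by simp
    have j2: "joined P q b (dist q b + 16 * D * real (card (hit q b)))"
      using less.hyps[of q b] card less.prems pqP by simp
    have "joined P a b ((dist a p + 16 * D * real (card (hit a p))) + 16 * D
        + (dist q b + 16 * D * real (card (hit q b))))"
      using joined_trans[OF joined_trans[OF j1 hole_frontier_joined[OF i(1) pq]] j2] .
    moreover have "dist a p + dist q b \<le> dist a b"
    proof -
      have "dist a p = t1 * norm d" using t1 by (simp add: p_def dist_norm)
      moreover have "b - q = (1 - t2) *\<^sub>R d" by (simp add: q_def d_def algebra_simps)
      then have "dist q b = (1 - t2) * norm d" using t2 by (simp add: dist_commute dist_norm)
      moreover have "dist a b = norm d" by (simp add: d_def dist_norm norm_minus_commute)
      moreover have "t1 * norm d \<le> t2 * norm d" using t1 t2 by (intro mult_right_mono) auto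
      ultimately show ?thesis by (simp add: algebra_simps)
    qed
    moreover have "16 * D * (real (card (hit a p)) + real (card (hit q b)) + 1) \<le> 16 * D * real (card (hit a b))"
      using card D_pos by (intro mult_left_mono) auto
    ultimately show ?thesis by (elim joined_mono) (simp add: algebra_simps)
  qed
qed

text \<open>Follow the level line of \<open>e\<close> through \<open>q\<close> until it leaves
  \<open>P0\<close>. Every hole on the way meets that level line, so their number bounds the number
  of detours.\<close>

lemma line_walk:
  assumes q: "q \<in> P" and e: "e \<noteq> 0" and Dm: "\<And>x y. x \<in> P0 \<Longrightarrow> y \<in> P0 \<Longrightarrow> dist x y \<le> Dm"
  shows "\<exists>z\<in>frontier P0. joined P q z (Dm + 16 * D * real (card {i\<in>{1..h}. \<exists>x\<in>H i. e \<bullet> x = e \<bullet> q}))"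
proof -
  have qP0: "q \<in> P0" using q by (simp add: P_iff)
  have Dm0: "Dm \<ge> 0" using Dm[OF qP0 qP0] by simp
  \<comment> \<open>At distance \<open>Dm + 1\<close> from \<open>q\<close> along the level line,
    hence outside \<open>P0\<close>.\<close>
  define b where "b = q + ((Dm + 1) / norm e) *\<^sub>R perp e"
  have "dist q b = Dm + 1" using e Dm0 by (simp add: b_def dist_norm)
  then have b: "b \<notin> P0" using Dm[OF qP0, of b] by auto
  have "closed_segment q b \<inter> frontier P0 \<noteq> {}"
    using qP0 b by (intro connected_Int_frontier) auto
  then obtain z where z: "z \<in> closed_segment q b" "z \<in> frontier P0" by auto
  have zP: "z \<in> P" using z outer_frontier_subset by auto
  have eb: "e \<bullet> b = e \<bullet> q" by (simp add: b_def inner_add_right)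
  have level: "e \<bullet> x = e \<bullet> q" if "x \<in> closed_segment q z" for x
  proof -
    have "x \<in> closed_segment q b" using that z(1) subset_closed_segment[of q z q b] by auto
    then show ?thesis using eb by (auto simp: in_segment inner_add_right left_diff_distrib)
  qed
  have "hit q z \<subseteq> {i\<in>{1..h}. \<exists>x\<in>H i. e \<bullet> x = e \<bullet> q}"
  proof
    fix i assume i: "i \<in> hit q z"
    then obtain x where "x \<in> closed_segment q z" "x \<in> interior (H i)" by (auto simp: hit_def)
    then have "x \<in> H i" "e \<bullet> x = e \<bullet> q" using level interior_subset by blast+
    then show "i \<in> {i\<in>{1..h}. \<exists>x\<in>H i. e \<bullet> x = e \<bullet> q}" using i by (auto simp: hit_def)
  qed
  then have "card (hit q z) \<le> card {i\<in>{1..h}. \<exists>x\<in>H i. e \<bullet> x = e \<bullet> q}" by (intro card_mono) auto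
  moreover have "dist q z \<le> Dm" using Dm qP0 zP by (simp add: P_iff)
  ultimately have "dist q z + 16 * D * real (card (hit q z)) \<le>
      Dm + 16 * D * real (card {i\<in>{1..h}. \<exists>x\<in>H i. e \<bullet> x = e \<bullet> q})"
    using D_pos by (intro add_mono mult_left_mono) auto
  then show ?thesis using joined_mono[OF detour[OF q zP]] z by blast
qed

text \<open>Averaging over \<open>t\<close>, with edges weighted by their length: each edge is steep
  only for \<open>t\<close> in a window of length \<open>8 / k\<close>.\<close>

lemma good_direction:
  assumes h: "h \<ge> 1" and k: "2 \<le> k"
  shows "\<exists>t. 0 \<le> t \<and> t \<le> 1 \<and> generic (tilt t) edges \<and>
    sum (steep_length k (tilt t)) edges \<le> 128 * real h * D / k"
proof -
  define A where "A d t \<longleftrightarrow> k * \<bar>tilt t \<bullet> (snd d - fst d)\<bar> < dist (fst d) (snd d)" for d :: "pt \<times> pt" and t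
  \<comment> \<open>The window is centred at the zero of \<open>t\<close> \<mapsto>
    \<open>tilt t \<bullet> (snd d - fst d)\<close>. Steepness with \<open>2 \<le> k\<close> forces
    the second coordinate of the edge vector to be nonzero, so a zero denominator never
    matters.\<close>
  define l where "l d = - ((snd d - fst d) $ 1 / (snd d - fst d) $ 2) - 4 / k" for d :: "pt \<times> pt"
  have "\<exists>t. 0 \<le> t \<and> t \<le> 1 \<and> t \<notin> {t. \<not> generic (tilt t) edges} \<and>
      (\<Sum>d\<in>{d\<in>edges. A d t}. dist (fst d) (snd d)) < 128 * real h * D / k"
  proof (rule averaging[where \<mu> = "8 / k" and l = l])
    show "finite edges" by (rule finite_edges)
    show "finite {t. \<not> generic (tilt t) edges}" by (rule finite_not_generic[OF finite_edges edges_ne])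
    \<comment> \<open>The average is at most \<open>64 * real h * D / k\<close>; doubling it yields
      the strict inequality that \<open>averaging\<close> needs.\<close>
    have "8 / k * (\<Sum>d\<in>edges. dist (fst d) (snd d)) \<le> 8 / k * (8 * real h * D)"
      using edges_length k by (intro mult_left_mono) (auto simp: case_prod_unfold)
    also have "\<dots> < 128 * real h * D / k * (1 - 0)" using h k D_pos by (simp add: field_simps)
    finally show "8 / k * (\<Sum>d\<in>edges. dist (fst d) (snd d)) < 128 * real h * D / k * (1 - 0)" .
    fix d t assume t: "0 \<le> t" "t \<le> 1" and A: "A d t"
    define w where "w = snd d - fst d"
    have Aw: "k * \<bar>w $ 1 + t * w $ 2\<bar> < norm w"
      using A by (simp add: A_def w_def tilt_inner dist_norm norm_minus_commute)
    have "2 * \<bar>w $ 1 + t * w $ 2\<bar> \<le> k * \<bar>w $ 1 + t * w $ 2\<bar>" using k by (intro mult_right_mono) auto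
    then have half: "\<bar>w $ 1 + t * w $ 2\<bar> < norm w / 2" using Aw by simp
    have "\<bar>t * w $ 2\<bar> \<le> \<bar>w $ 2\<bar>" using t by (simp add: abs_mult mult_left_le_one_le)
    moreover have "norm w \<le> \<bar>w $ 1\<bar> + \<bar>w $ 2\<bar>" using norm_le_l1_cart[of w] by (simp add: sum_2)
    \<comment> \<open>The norm is at most
      \<open>\<bar>w $ 1 + t * w $ 2\<bar> + 2 * \<bar>w $ 2\<bar>\<close>, and the first term is
      below half the norm.\<close>
    ultimately have w2: "norm w < 4 * \<bar>w $ 2\<bar>" using half by linarith
    then have w2': "\<bar>w $ 2\<bar> > 0" using norm_ge_zero[of w] by linarith
    have "w $ 1 + t * w $ 2 = (t + w $ 1 / w $ 2) * w $ 2" using w2' by (simp add: field_simps)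
    then have "k * (\<bar>t + w $ 1 / w $ 2\<bar> * \<bar>w $ 2\<bar>) < 4 * \<bar>w $ 2\<bar>"
      using Aw w2 by (simp add: abs_mult)
    then have "\<bar>t + w $ 1 / w $ 2\<bar> < 4 / k" using w2' k by (simp add: field_simps)
    then show "l d \<le> t \<and> t \<le> l d + 8 / k" unfolding l_def w_def[symmetric] by (auto simp: abs_less_iff)
  qed (use k in auto)
  then obtain t where t: "0 \<le> t" "t \<le> 1" "generic (tilt t) edges"
      "(\<Sum>d\<in>{d\<in>edges. A d t}. dist (fst d) (snd d)) < 128 * real h * D / k" by auto
  have "sum (steep_length k (tilt t)) edges = (\<Sum>d\<in>{d\<in>edges. A d t}. dist (fst d) (snd d))"
    using finite_edges by (simp add: sum.inter_filter steep_length_def A_def)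
  then show ?thesis using t by auto
qed

lemma greedy_tilt:
  assumes h: "h \<ge> 1" and k: "2 \<le> k"
  shows "\<exists>e. 1 \<le> norm e \<and> norm e \<le> 2 \<and> (\<forall>p\<in>P. \<forall>T. e \<bullet> p \<le> T \<longrightarrow>
    (\<exists>q\<in>P. e \<bullet> p \<le> e \<bullet> q \<and> e \<bullet> q \<le> T \<and> (q \<in> frontier P0 \<or> e \<bullet> q = T) \<and>
      joined P p q (k * (e \<bullet> q - e \<bullet> p) + 128 * real h * D / k)))"
proof -
  obtain t where t: "0 \<le> t" "t \<le> 1" "generic (tilt t) edges"
      "sum (steep_length k (tilt t)) edges \<le> 128 * real h * D / k"
    using good_direction[OF assms] by blast
  have "sum (steep_length k (tilt t)) (above (tilt t) edges \<tau>) \<le> 128 * real h * D / k" for \<tau>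
    using t(4) sum_mono2[of edges "above (tilt t) edges \<tau>" "steep_length k (tilt t)"]
      finite_edges steep_length_nonneg by (force simp: above_def)
  then have le: "x + sum (steep_length k (tilt t)) (above (tilt t) edges \<tau>) \<le> x + 128 * real h * D / k" for x \<tau>
    by simp
  have "\<exists>q\<in>P. tilt t \<bullet> p \<le> tilt t \<bullet> q \<and> tilt t \<bullet> q \<le> T \<and> (q \<in> frontier P0 \<or> tilt t \<bullet> q = T) \<and>
      joined P p q (k * (tilt t \<bullet> q - tilt t \<bullet> p) + 128 * real h * D / k)"
    if "p \<in> P" "tilt t \<bullet> p \<le> T" for p T
  proof -
    have "1 \<le> k" using k by simp
    from greedy[OF t(3) norm_tilt(1)[OF t(1,2)] this that] joined_mono[OF _ le]
    show ?thesis by blast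
  qed
  then show ?thesis using norm_tilt[OF t(1,2)] by blast
qed

text \<open>As \<open>norm e \<le> 2\<close>, heights in \<open>P0\<close> differ by at most
  \<open>2 * Dm\<close>. The target level \<open>e \<bullet> s + 3 * Dm\<close> is out of reach, so
  the walk can only end on the outer boundary.\<close>

lemma reach_outer_greedy:
  assumes h: "h \<ge> 1" and k: "2 \<le> k" and s: "s \<in> P"
    and Dm: "\<And>x y. x \<in> P0 \<Longrightarrow> y \<in> P0 \<Longrightarrow> dist x y \<le> Dm" "0 < Dm"
  shows "\<exists>z\<in>frontier P0. joined P s z (2 * k * Dm + 128 * real h * D / k)"
proof -
  obtain e where e: "norm e \<le> 2" "\<And>p T. p \<in> P \<Longrightarrow> e \<bullet> p \<le> T \<Longrightarrow>
    (\<exists>q\<in>P. e \<bullet> p \<le> e \<bullet> q \<and> e \<bullet> q \<le> T \<and> (q \<in> frontier P0 \<or> e \<bullet> q = T) \<and>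
      joined P p q (k * (e \<bullet> q - e \<bullet> p) + 128 * real h * D / k))"
    using greedy_tilt[OF h k] by blast
  obtain q where q: "q \<in> P" "q \<in> frontier P0 \<or> e \<bullet> q = e \<bullet> s + 3 * Dm"
      "joined P s q (k * (e \<bullet> q - e \<bullet> s) + 128 * real h * D / k)"
    using e(2)[OF s, of "e \<bullet> s + 3 * Dm"] Dm(2) by auto
  have "e \<bullet> q - e \<bullet> s \<le> norm e * norm (q - s)"
    using norm_cauchy_schwarz[of e "q - s"] by (simp add: inner_diff_right)
  also have "\<dots> \<le> 2 * Dm"
    using e(1) Dm(1)[of q s] q(1) s by (intro mult_mono) (auto simp: P_iff dist_norm)
  finally have le: "e \<bullet> q - e \<bullet> s \<le> 2 * Dm" .
  then have "q \<in> frontier P0" using q(2) Dm(2) by auto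
  moreover have "k * (e \<bullet> q - e \<bullet> s) \<le> k * (2 * Dm)" using le k by (intro mult_left_mono) auto
  ultimately show ?thesis using q(3) by (intro bexI[of _ q]) (auto elim!: joined_mono)
qed

text \<open>Averaging over the levels within \<open>\<rho>\<close> above \<open>s\<close> finds one
  that meets fewer than \<open>c\<close> holes. Either the greedy walk hits the outer boundary
  before that level, or \<open>line_walk\<close> continues along it.\<close>

lemma reach_outer_line:
  assumes h: "h \<ge> 1" and k: "2 \<le> k" and s: "s \<in> P"
    and Dm: "\<And>x y. x \<in> P0 \<Longrightarrow> y \<in> P0 \<Longrightarrow> dist x y \<le> Dm" "0 < Dm"
    and \<rho>: "0 < \<rho>" and c: "4 * D * real h < c * \<rho>"
  shows "\<exists>z\<in>frontier P0. joined P s z (k * \<rho> + 128 * real h * D / k + Dm + 16 * D * c)"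
proof -
  obtain e where e: "1 \<le> norm e" "norm e \<le> 2" "\<And>p T. p \<in> P \<Longrightarrow> e \<bullet> p \<le> T \<Longrightarrow>
    (\<exists>q\<in>P. e \<bullet> p \<le> e \<bullet> q \<and> e \<bullet> q \<le> T \<and> (q \<in> frontier P0 \<or> e \<bullet> q = T) \<and>
      joined P p q (k * (e \<bullet> q - e \<bullet> p) + 128 * real h * D / k))"
    using greedy_tilt[OF h k] by blast
  have e0: "e \<noteq> 0" using e(1) by auto
  have "0 \<le> 4 * D * real h" using D_pos by simp
  then have "0 < c * \<rho>" using c by linarith
  then have c0: "c > 0" using zero_less_mult_pos2 \<rho> by blast
  define A where "A i y \<longleftrightarrow> (\<exists>x\<in>H i. e \<bullet> x = y)" for i y
  \<comment> \<open>Heights in a hole differ by at most \<open>2 * D\<close> from that of a fixed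
    reference point, because \<open>norm e \<le> 2\<close>; hence a window of length
    \<open>4 * D\<close>.\<close>
  define l where "l i = e \<bullet> (SOME x. x \<in> H i) - 2 * D" for i
  have "\<exists>y. e \<bullet> s \<le> y \<and> y \<le> e \<bullet> s + \<rho> \<and> y \<notin> {} \<and> (\<Sum>i\<in>{i\<in>{1..h}. A i y}. 1) < c"
  proof (rule averaging[where \<mu> = "4 * D" and l = l])
    show "4 * D * (\<Sum>i = 1..h. 1) < c * (e \<bullet> s + \<rho> - e \<bullet> s)" using c by simp
    fix i y assume i: "i \<in> {1..h}" and "A i y"
    then obtain x where x: "x \<in> H i" "e \<bullet> x = y" by (auto simp: A_def)
    define x0 where "x0 = (SOME x. x \<in> H i)"
    have x0: "x0 \<in> H i" unfolding x0_def using x(1) by (rule someI)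
    have "\<bar>e \<bullet> (x - x0)\<bar> \<le> norm e * norm (x - x0)" by (rule Cauchy_Schwarz_ineq2)
    also have "\<dots> \<le> 2 * D"
      using e(2) dist_le_diam_2[OF compact_imp_bounded[OF compact_hole[OF i]] x(1) x0] hole_diam[OF i]
      by (intro mult_mono) (auto simp: dist_norm)
    finally show "l i \<le> y \<and> y \<le> l i + 4 * D"
      using x(2) by (auto simp: l_def x0_def[symmetric] inner_diff_right abs_le_iff)
  qed (use D_pos \<rho> in auto)
  then obtain y where y: "e \<bullet> s \<le> y" "y \<le> e \<bullet> s + \<rho>" "real (card {i\<in>{1..h}. A i y}) < c" by auto
  obtain q where q: "q \<in> P" "e \<bullet> q \<le> y" "q \<in> frontier P0 \<or> e \<bullet> q = y"
      "joined P s q (k * (e \<bullet> q - e \<bullet> s) + 128 * real h * D / k)"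
    using e(3)[OF s y(1)] by blast
  have "k * (e \<bullet> q - e \<bullet> s) \<le> k * \<rho>" using q(2) y(2) k by (intro mult_left_mono) auto
  then have sq: "joined P s q (k * \<rho> + 128 * real h * D / k)" using q(4) by (auto elim!: joined_mono)
  show ?thesis
  proof (cases "q \<in> frontier P0")
    case True
    have "0 \<le> Dm + 16 * D * c" using Dm(2) D_pos c0 by simp
    then show ?thesis using True joined_mono[OF sq] by (intro bexI[of _ q]) auto
  next
    case False
    then have qy: "e \<bullet> q = y" using q(3) by simp
    obtain z where z: "z \<in> frontier P0" "joined P q z (Dm + 16 * D * real (card {i\<in>{1..h}. A i y}))"
      using line_walk[OF q(1) e0 Dm(1)] unfolding qy A_def by blast
    have "16 * D * real (card {i\<in>{1..h}. A i y}) \<le> 16 * D * c"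
      using y(3) D_pos by (intro mult_left_mono) auto
    then have "joined P q z (Dm + 16 * D * c)" using z(2) by (auto elim!: joined_mono)
    from joined_trans[OF sq this] show ?thesis using z(1) by (auto simp: add.assoc)
  qed
qed

end

section \<open>The distortion bound\<close>

text \<open>A compact convex set is the convex hull of its boundary and balls are convex, so a
  distance bound extends from boundary points to all points, one argument at a time. This compares
  the diameter of \<open>P0\<close> with that of \<open>P\<close>, which contains the boundary of
  \<open>P0\<close> but lacks the interiors of the holes.\<close>

lemma (in polygon_edges) dist_le_of_frontier:
  assumes B: "\<And>x y. x \<in> frontier Q \<Longrightarrow> y \<in> frontier Q \<Longrightarrow> dist x y \<le> B"
    and xy: "x \<in> Q" "y \<in> Q"
  shows "dist x y \<le> B"
proof -
  have Q: "Q = convex hull (frontier Q)" using Krein_Milman_frontier[OF convex_Q compact_Q] .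
  have *: "Q \<subseteq> cball z B" if "\<And>w. w \<in> frontier Q \<Longrightarrow> dist z w \<le> B" for z
    using that by (subst Q, intro hull_minimal) auto
  have "dist z w \<le> B" if "z \<in> frontier Q" "w \<in> Q" for z w
    using *[of z] B[OF that(1)] that(2) by auto
  then have "Q \<subseteq> cball x B" using xy(1) by (intro *) (simp add: dist_commute)
  then show ?thesis using xy(2) by auto
qed

lemma (in small_holes) reach_outer:
  assumes h: "h \<ge> 1" and \<Delta>: "\<Delta> > 0" and D: "D = \<Delta> * Dm" and s: "s \<in> P"
    and Dm: "\<And>x y. x \<in> P0 \<Longrightarrow> y \<in> P0 \<Longrightarrow> dist x y \<le> Dm" "0 < Dm"
  shows "\<exists>z\<in>frontier P0. joined P s z
    (Dm * (4 + 146 * min (real h powr (3/4) * \<Delta>) (real h powr (1/2) * \<Delta> powr (1/2))))"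
proof (cases "real h powr (3/4) * \<Delta> \<le> real h powr (1/2) * \<Delta> powr (1/2)")
  case True
  define a where "a = real h powr (1/4)"
  have a1: "a \<ge> 1" using h by (simp add: a_def ge_one_powr_ge_zero)
  have pw: "real h powr (3/4) = a ^ 3" "real h = a ^ 4"
    using h by (simp_all add: a_def powr_powr flip: powr_realpow)
  have D0: "D > 0" by (rule D_pos)
  have a2: "a\<^sup>2 > 0" "a\<^sup>2 \<le> a ^ 3" using a1 by (auto intro: power_increasing)
  \<comment> \<open>The choices are \<open>\<rho> = a\<^sup>2 * D\<close>,
    \<open>c = 5 * a\<^sup>2\<close> and \<open>k = 2 * a\<close>; the factor 5 instead of 4 gives
    strictness. In units of \<open>a ^ 3 * D\<close> the costs are 2, 64 and at most 80, which sum
    to 146.\<close>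
  have "4 * D * real h < 5 * a\<^sup>2 * (a\<^sup>2 * D)"
    using D0 a1 by (simp add: pw power_numeral_reduce)
  then have "\<exists>z\<in>frontier P0. joined P s z
      (2 * a * (a\<^sup>2 * D) + 128 * real h * D / (2 * a) + Dm + 16 * D * (5 * a\<^sup>2))"
    using a1 a2 D0 by (intro reach_outer_line[OF h _ s Dm]) auto
  moreover have "2 * a * (a\<^sup>2 * D) + 128 * real h * D / (2 * a) + Dm + 16 * D * (5 * a\<^sup>2)
      \<le> Dm * (4 + 146 * (a ^ 3 * \<Delta>))"
  proof -
    have "128 * real h * D / (2 * a) = 64 * a ^ 3 * D"
      using a1 by (simp add: pw power_numeral_reduce)
    moreover have "2 * a * (a\<^sup>2 * D) = 2 * a ^ 3 * D" by (simp add: power_numeral_reduce)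
    moreover have "16 * D * (5 * a\<^sup>2) \<le> 80 * a ^ 3 * D" using a2 D0 by simp
    moreover have "Dm * (4 + 146 * (a ^ 3 * \<Delta>)) = 4 * Dm + 146 * a ^ 3 * D" by (simp add: D algebra_simps)
    ultimately show ?thesis using Dm(2) by linarith
  qed
  moreover have "min (real h powr (3/4) * \<Delta>) (real h powr (1/2) * \<Delta> powr (1/2)) = a ^ 3 * \<Delta>"
    using True unfolding pw(1) by (rule min.absorb1)
  ultimately show ?thesis using joined_mono by (simp only:) blast
next
  case False
  define b where "b = real h powr (1/2) * \<Delta> powr (1/2)"
  have b0: "b > 0" using h \<Delta> by (simp add: b_def)
  have bb: "b * b = real h * \<Delta>"
    using h \<Delta> by (simp add: b_def mult.assoc mult.left_commute flip: powr_add)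
  \<comment> \<open>Here \<open>k = 2 + b\<close>: the summand 2 secures \<open>2 \<le> k\<close>
    when \<open>b\<close> is small, and \<open>b\<close> balances the two cost terms when it is
    large.\<close>
  have "\<exists>z\<in>frontier P0. joined P s z (2 * (2 + b) * Dm + 128 * real h * D / (2 + b))"
    using b0 by (intro reach_outer_greedy[OF h _ s Dm]) auto
  moreover have "2 * (2 + b) * Dm + 128 * real h * D / (2 + b) \<le> Dm * (4 + 146 * b)"
  proof -
    have "128 * real h * D / (2 + b) \<le> 128 * b * Dm"
    proof -
      have "128 * real h * D = 128 * (b * b) * Dm" by (simp add: D bb)
      also have "\<dots> \<le> 128 * b * Dm * (2 + b)" using b0 Dm(2) by (simp add: algebra_simps)
      finally show ?thesis using b0 by (simp add: field_simps)
    qed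
    moreover have "0 \<le> 16 * (b * Dm)" using b0 Dm(2) by simp
    ultimately show ?thesis by (simp add: algebra_simps)
  qed
  moreover have "min (real h powr (3/4) * \<Delta>) (real h powr (1/2) * \<Delta> powr (1/2)) = b"
    using False unfolding b_def by (intro min.absorb2) simp
  ultimately show ?thesis using joined_mono by (simp only:) blast
qed

lemma distortion_bound:
  assumes h: "h \<ge> 1" and \<Delta>: "\<Delta> > 0" and C: "in_class_C h P0 H"
    and diam: "\<forall>i\<in>{1..h}. diam_2 (H i) \<le> \<Delta> * diam_2 (poly_domain h P0 H)"
  shows "distortion (poly_domain h P0 H)
    \<le> 300 * (1 + min (real h powr (3/4) * \<Delta>) (real h powr (1/2) * \<Delta> powr (1/2)))"
proof -
  define P where "P = poly_domain h P0 H"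
  define Dm where "Dm = diam_2 P"
  define X where "X = min (real h powr (3/4) * \<Delta>) (real h powr (1/2) * \<Delta> powr (1/2))"
  have X0: "X \<ge> 0" using \<Delta> by (simp add: X_def)
  obtain E0 where E0: "polygon_edges P0 E0" using C convex_polygon_edges unfolding in_class_C_def by blast
  have "\<forall>i\<in>{1..h}. \<exists>E. polygon_edges (H i) E" using C convex_polygon_edges unfolding in_class_C_def by blast
  then obtain EE where EE: "\<And>i. i \<in> {1..h} \<Longrightarrow> polygon_edges (H i) (EE i)" by metis
  interpret holed_domain h P0 H E0 EE P
    using C unfolding in_class_C_def by (intro holed_domain.intro P_def E0 EE) blast+
  note front = outer_frontier_subset
  have bddP: "bounded P"
    using compact_P0 compact_imp_bounded bounded_subset[of P0 P]
    by (auto simp: P_def poly_domain_def)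
  have Dm: "dist x y \<le> Dm" if "x \<in> P0" "y \<in> P0" for x y
    using front dist_le_diam_2[OF bddP] unfolding Dm_def
    by (intro polygon_edges.dist_le_of_frontier[OF E0 _ that]) blast
  \<comment> \<open>A ball inside \<open>P0\<close> shows that the diameter is positive, so dividing
    by it is meaningful.\<close>
  have "interior P0 \<noteq> {}" using C by (auto simp: in_class_C_def convex_polygon_def)
  then obtain x r where xr: "r > 0" "cball x r \<subseteq> P0" using mem_interior_cball by blast
  then obtain y where y: "dist x y = r" using vector_choose_dist[of r x] by auto
  have "x \<in> cball x r" "y \<in> cball x r" using xr(1) y by auto
  then have "dist x y \<le> Dm" using xr(2) by (intro Dm) auto
  then have Dm0: "Dm > 0" using xr(1) y by simp
  have P0ne: "P0 \<noteq> {}" using xr by auto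
  have Pne: "P \<noteq> {}"
    using front P0ne Krein_Milman_frontier[OF convex_P0 compact_P0]
    by auto
  interpret small_holes h P0 H E0 EE P "\<Delta> * Dm"
    using diam \<Delta> Dm0 by unfold_locales (auto simp: P_def Dm_def)
  have d0: "diam_2 P0 \<le> Dm" unfolding diam_2_def using P0ne Dm by (intro cSUP_least) auto
  \<comment> \<open>Both points walk to the outer boundary and are joined along it: twice
    \<open>4 + 146 * X\<close> plus 16 is \<open>24 + 292 * X\<close>.\<close>
  have "geod P s t \<le> Dm * (300 * (1 + X))" if st: "s \<in> P" "t \<in> P" for s t
  proof -
    obtain z where z: "z \<in> frontier P0" "joined P s z (Dm * (4 + 146 * X))"
      using reach_outer[OF h \<Delta> refl st(1) Dm Dm0] unfolding X_def by blast
    obtain w where w: "w \<in> frontier P0" "joined P t w (Dm * (4 + 146 * X))"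
      using reach_outer[OF h \<Delta> refl st(2) Dm Dm0] unfolding X_def by blast
    have "joined P z w (16 * diam_2 P0)"
      using polygon_edges.frontier_joined[OF E0 z(1) w(1)] front by (rule joined_subset)
    then have "joined P z w (16 * Dm)" using d0 by (elim joined_mono) simp
    from joined_trans[OF joined_trans[OF z(2) this] joined_sym[OF w(2)]]
    have "geod P s t \<le> Dm * (4 + 146 * X) + 16 * Dm + Dm * (4 + 146 * X)" by (rule geod_le_joined)
    also have "\<dots> = Dm * (24 + 292 * X)" by (simp add: algebra_simps)
    also have "\<dots> \<le> Dm * (300 * (1 + X))" using Dm0 X0 by (intro mult_left_mono) auto
    finally show ?thesis .
  qed
  then have "diam_g P \<le> Dm * (300 * (1 + X))"
    unfolding diam_g_def using Pne by (intro cSUP_least) auto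
  then show ?thesis
    using Dm0 unfolding distortion_def P_def[symmetric] Dm_def[symmetric] X_def[symmetric]
    by (simp add: divide_le_eq mult.commute)
qed

theorem theorem2:
  shows "(\<exists>C>0. \<forall>(h::nat) (\<Delta>::real) P0 H.
            h \<ge> 1 \<longrightarrow> \<Delta> > 0 \<longrightarrow> in_class_C h P0 H \<longrightarrow>
            (\<forall>i\<in>{1..h}. diam_2 (H i) \<le> \<Delta> * diam_2 (poly_domain h P0 H)) \<longrightarrow>
            distortion (poly_domain h P0 H)
              \<le> C * (1 + min (real h powr (3/4) * \<Delta>) (real h powr (1/2) * \<Delta> powr (1/2))))
       \<and> (\<forall>c>0. \<exists>C'. \<forall>(h::nat) (\<Delta>::real) P0 H.
            h \<ge> 1 \<longrightarrow> \<Delta> > 0 \<longrightarrow> \<Delta> \<le> c * real h powr (-1/3) \<longrightarrow> in_class_C h P0 H \<longrightarrow>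
            (\<forall>i\<in>{1..h}. diam_2 (H i) \<le> \<Delta> * diam_2 (poly_domain h P0 H)) \<longrightarrow>
            distortion (poly_domain h P0 H) \<le> C' * real h powr (1/3))"
proof (intro conjI allI impI)
  show "\<exists>C>0. \<forall>(h::nat) (\<Delta>::real) P0 H.
            h \<ge> 1 \<longrightarrow> \<Delta> > 0 \<longrightarrow> in_class_C h P0 H \<longrightarrow>
            (\<forall>i\<in>{1..h}. diam_2 (H i) \<le> \<Delta> * diam_2 (poly_domain h P0 H)) \<longrightarrow>
            distortion (poly_domain h P0 H)
              \<le> C * (1 + min (real h powr (3/4) * \<Delta>) (real h powr (1/2) * \<Delta> powr (1/2)))"
    by (intro exI[of _ 300] conjI allI impI distortion_bound) simp_all
next
  fix c :: real assume c: "c > 0"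
  show "\<exists>C'. \<forall>(h::nat) (\<Delta>::real) P0 H.
            h \<ge> 1 \<longrightarrow> \<Delta> > 0 \<longrightarrow> \<Delta> \<le> c * real h powr (-1/3) \<longrightarrow> in_class_C h P0 H \<longrightarrow>
            (\<forall>i\<in>{1..h}. diam_2 (H i) \<le> \<Delta> * diam_2 (poly_domain h P0 H)) \<longrightarrow>
            distortion (poly_domain h P0 H) \<le> C' * real h powr (1/3)"
  proof (intro exI[of _ "300 * (1 + c powr (1/2))"] allI impI)
    fix h :: nat and \<Delta> :: real and P0 H
    assume h: "h \<ge> 1" and \<Delta>: "\<Delta> > 0" and \<Delta>c: "\<Delta> \<le> c * real h powr (-1/3)"
      and *: "in_class_C h P0 H" "\<forall>i\<in>{1..h}. diam_2 (H i) \<le> \<Delta> * diam_2 (poly_domain h P0 H)"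
    \<comment> \<open>Only the second term of the minimum is needed: the exponent of
      \<open>h\<close> becomes 1/2 - 1/6 = 1/3.\<close>
    have "real h powr (1/2) * \<Delta> powr (1/2) \<le> real h powr (1/2) * (c * real h powr (-1/3)) powr (1/2)"
      using \<Delta> \<Delta>c by (intro mult_left_mono powr_mono2) auto
    also have "\<dots> = c powr (1/2) * (real h powr (1/2) * real h powr (-1/6))"
      using c by (simp add: powr_mult powr_powr)
    also have "\<dots> = c powr (1/2) * real h powr (1/3)"
      by (simp flip: powr_add)
    finally have le: "real h powr (1/2) * \<Delta> powr (1/2) \<le> c powr (1/2) * real h powr (1/3)" .
    have one: "1 \<le> real h powr (1/3)" using h by (simp add: ge_one_powr_ge_zero)
    have "distortion (poly_domain h P0 H)
        \<le> 300 * (1 + min (real h powr (3/4) * \<Delta>) (real h powr (1/2) * \<Delta> powr (1/2)))"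
      by (rule distortion_bound[OF h \<Delta> *])
    also have "\<dots> \<le> 300 * (real h powr (1/3) + c powr (1/2) * real h powr (1/3))"
      using le one by (intro mult_left_mono add_mono) auto
    also have "\<dots> = 300 * (1 + c powr (1/2)) * real h powr (1/3)" by (simp add: algebra_simps)
    finally show "distortion (poly_domain h P0 H) \<le> 300 * (1 + c powr (1/2)) * real h powr (1/3)" .
  qed
qed

end
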